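(* Define, for $(w,x)\in\mathcal H_{++}$, $$\bar v(w,x):=\frac{f_\infty^{\gamma}\,\Gamma_\infty(w,x)^{1-\gamma}}{1-\gamma},$$ where $f_\infty=(1+\delta k^{-b})\nu>0$. Then $\bar v$ is a classical solution on $\mathcal H_{++}$ of the HJB equation $$(\rho+\delta)v=\mathbb H\big(w,x,Dv,D^2_{wx_0}v\big).$$
   Context: Data: $n\ge1$, $d>0$, $r,\mu_y\in\mathbb R$, $\mu,\sigma_y\in\mathbb R^n$, $\sigma\in\mathbb R^{n\times n}$ invertible, $\phi\in L^2(-d,0;\mathbb R)$, $\delta,k,\rho>0$, $\gamma\in(0,1)\cup(1,\infty)$, $\mathbf 1=(1,\dots,1)^\top\in\mathbb R^n$. Put $$\kappa=\sigma^{-1}(\mu-r\mathbf 1),\quad \beta=r+\delta-\mu_y+\sigma_y^\top\kappa,\quad \beta_\infty=\int_{-d}^0e^{(r+\delta)s}\phi(s)ds,\quad \overline\beta_\infty=\int_{-d}^0e^{(r+\delta)s}|\phi(s)|ds.$$ Standing assumptions: $\beta-\overline\beta_\infty>0$ and $\rho+\delta-(1-\gamma)\big(r+\delta+\frac{\kappa^\top\kappa}{2\gamma}\big)>0$. Put $$b=1-\tfrac1\gamma,\quad \nu=\frac{\gamma}{\rho+\delta-(1-\gamma)(r+\delta+\frac{\kappa^\top\kappa}{2\gamma})}>0,\quad g_\infty=\frac1{\beta-\beta_\infty},\quad h_\infty(s)=g_\infty\int_{-d}^se^{-(r+\delta)(s-\tau)}\phi(\tau)d\tau .$$ $M_2=\mathbb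 R\times L^2(-d,0;\mathbb R)$ with its natural inner product, $\mathcal H=\mathbb R\times M_2$, $\Gamma_\infty(w,x)=w+g_\infty x_0+\langle h_\infty,x_1\rangle_{L^2}$ for $x=(x_0,x_1)\in M_2$, $\mathcal H_{++}=\{\Gamma_\infty>0\}\subset\mathcal H$. The operator $A^*$ on $M_2$ has domain $\mathcal D(A^* )=\{(y_0,y_1)\in M_2:\ y_1\in W^{1,2}([-d,0];\mathbb R),\ y_1(-d)=0\}$ and $A^*(y_0,y_1)=(\mu_yy_0+y_1(0),\,-y_1'+y_0\phi)$. For $u:\mathcal H_{++}\to\mathbb R$, $Du=(u_w,u_x)=(u_w,(u_{x_0},u_{x_1}))\in\mathcal H$ is the gradient and $D^2_{wx_0}u$ is the symmetric $2\times2$ matrix of second derivatives in $(w,x_0)$. For $(w,x)\in\mathcal H$, $p=(p_1,p_2)\in\mathbb R\times\mathcal D(A^* )$ and a symmetric real $2\times 2$ matrix $P=(P_{ij})$, the Hamiltonian (with values in $[-\infty,+\infty]$) is $$\mathbb H(w,x,p,P)=(r+\delta)wp_1+x_0p_1+\langle x,A^*p_2\rangle_{M_2}+\tfrac12\sigma_y^\top\sigma_y\,x_0^2P_{22}+\sup_{(c,B,\theta)\in\mathbb R_+\times\mathbb R_+\times\mathbb R^n}\mathbb H_{cv}(x_0,p_1,P_{11},P_{12};c,B,\theta),$$ $$\mathbb H_{cv}=\frac{c^{1-\gamma}}{1-\gamma}+\frac{\delta(kB)^{1-\gamma}}{1-\gamma}+\big[\theta^\top(\mu-r\mathbf 1)-c-\delta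 B\big]p_1+\tfrac12\theta^\top\sigma\sigma^\top\theta\,P_{11}+\theta^\top\sigma\sigma_y\,x_0P_{12},$$ with $0^{1-\gamma}/(1-\gamma)=-\infty$ if $\gamma>1$. A function $u:\mathcal H_{++}\to\mathbb R$ is a classical solution of the HJB equation in $\mathcal H_{++}$ if: (i) $u$ is continuously Fréchet differentiable in $\mathcal H_{++}$ and admits continuous second derivatives with respect to $(w,x_0)$ in $\mathcal H_{++}$; (ii) $u_x(w,x)\in\mathcal D(A^* )$ for every $(w,x)\in\mathcal H_{++}$ and $A^*u_x$ is continuous in $\mathcal H_{++}$; (iii) $(\rho+\delta)u-\mathbb H(w,x,Du,D^2_{wx_0}u)=0$ for all $(w,x)\in\mathcal H_{++}$. *)

theory Defs
  imports "HOL-Analysis.Analysis"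
begin

definition sq_integrable :: "(real \<Rightarrow> real) \<Rightarrow> bool" where
  "sq_integrable f \<longleftrightarrow> f \<in> borel_measurable lborel \<and> integrable lborel (\<lambda>s. (f s)\<^sup>2)"

lemma sq_integrable_zero: "sq_integrable (\<lambda>s. 0)"
  by (simp add: sq_integrable_def)

lemma sq_integrable_mult:
  assumes "sq_integrable f" "sq_integrable g"
  shows "integrable lborel (\<lambda>s. f s * g s)"
proof (rule Bochner_Integration.integrable_bound)
  show "integrable lborel (\<lambda>s. (f s)\<^sup>2 + (g s)\<^sup>2)"
    using assms by (simp add: sq_integrable_def)
  show "(\<lambda>s. f s * g s) \<in> borel_measurable lborel"
    using assms by (auto simp: sq_integrable_def)
  have "\<bar>a * b\<bar> \<le> a\<^sup>2 + b\<^sup>2" for a b :: real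
  proof -
    have "2 * (\<bar>a\<bar> * \<bar>b\<bar>) \<le> a\<^sup>2 + b\<^sup>2"
      using sum_squares_bound[of "\<bar>a\<bar>" "\<bar>b\<bar>"] by simp
    moreover have "0 \<le> \<bar>a\<bar> * \<bar>b\<bar>" by simp
    ultimately show ?thesis unfolding abs_mult by linarith
  qed
  then show "AE s in lborel. norm (f s * g s) \<le> norm ((f s)\<^sup>2 + (g s)\<^sup>2)"
    by simp
qed

lemma sq_integrable_add:
  assumes "sq_integrable f" "sq_integrable g"
  shows "sq_integrable (\<lambda>s. f s + g s)"
  using assms sq_integrable_mult[OF assms]
  by (auto simp: sq_integrable_def power2_sum mult.assoc)

lemma sq_integrable_scale: "sq_integrable f \<Longrightarrow> sq_integrable (\<lambda>s. c * f s)"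
  by (auto simp: sq_integrable_def power_mult_distrib)

definition l2_rel :: "(real \<Rightarrow> real) \<Rightarrow> (real \<Rightarrow> real) \<Rightarrow> bool" where
  "l2_rel f g \<longleftrightarrow> sq_integrable f \<and> sq_integrable g \<and> (AE s in lborel. f s = g s)"

text \<open>The elements of \<open>l2\<close> are the classes of \<open>L\<^sup>2(\<real>)\<close> modulo equality almost everywhere;
  \<open>L\<^sup>2(-d,0)\<close> is the subspace \<open>L2 d\<close> below of the classes vanishing outside \<open>[-d,0]\<close>.\<close>

quotient_type l2 = "real \<Rightarrow> real" / partial: l2_rel
proof (rule part_equivpI)
  show "\<exists>f. l2_rel f f"
    using sq_integrable_zero by (auto simp: l2_rel_def)
  show "symp l2_rel"
    by (auto simp: symp_def l2_rel_def elim: eventually_mono)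
  show "transp l2_rel"
  proof (rule transpI)
    fix f g h assume "l2_rel f g" "l2_rel g h"
    then have "sq_integrable f" "sq_integrable h"
      "AE s in lborel. f s = g s" "AE s in lborel. g s = h s"
      by (auto simp: l2_rel_def)
    moreover from this(3,4) have "AE s in lborel. f s = h s"
      by eventually_elim simp
    ultimately show "l2_rel f h" by (simp add: l2_rel_def)
  qed
qed

instantiation l2 :: real_vector
begin

lift_definition zero_l2 :: l2 is "\<lambda>s. 0"
  by (simp add: l2_rel_def sq_integrable_zero)

lift_definition plus_l2 :: "l2 \<Rightarrow> l2 \<Rightarrow> l2" is "\<lambda>f g s. f s + g s"
proof -
  fix f f' g g' assume a: "l2_rel f f'" "l2_rel g g'"
  then have "AE s in lborel. f s = f' s" "AE s in lborel. g s = g' s"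
    by (auto simp: l2_rel_def)
  then have "AE s in lborel. f s + g s = f' s + g' s"
    by eventually_elim simp
  with a show "l2_rel (\<lambda>s. f s + g s) (\<lambda>s. f' s + g' s)"
    by (simp add: l2_rel_def sq_integrable_add)
qed

lift_definition scaleR_l2 :: "real \<Rightarrow> l2 \<Rightarrow> l2" is "\<lambda>c f s. c * f s"
  by (auto simp: l2_rel_def sq_integrable_scale elim: eventually_mono)

definition uminus_l2 :: "l2 \<Rightarrow> l2" where "uminus_l2 f = (-1) *\<^sub>R f"
definition minus_l2 :: "l2 \<Rightarrow> l2 \<Rightarrow> l2" where "minus_l2 f g = f + (-1) *\<^sub>R (g :: l2)"

instance
proof
  fix f g h :: l2 and a b :: real
  show "f + g + h = f + (g + h)"
    by transfer (auto simp: l2_rel_def add.assoc sq_integrable_add)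
  show "f + g = g + f"
    by transfer (auto simp: l2_rel_def add.commute sq_integrable_add)
  show "0 + f = f"
    by transfer (auto simp: l2_rel_def)
  show "- f + f = 0"
    unfolding uminus_l2_def
    by transfer (auto simp: l2_rel_def sq_integrable_zero)
  show "f - g = f + - g"
    by (simp add: minus_l2_def uminus_l2_def)
  show "a *\<^sub>R (f + g) = a *\<^sub>R f + a *\<^sub>R g"
    by transfer (auto simp: l2_rel_def distrib_left intro!: sq_integrable_add sq_integrable_scale)
  show "(a + b) *\<^sub>R f = a *\<^sub>R f + b *\<^sub>R f"
    by transfer (auto simp: l2_rel_def distrib_right intro!: sq_integrable_add sq_integrable_scale)
  show "a *\<^sub>R b *\<^sub>R f = (a * b) *\<^sub>R f"
    by transfer (auto simp: l2_rel_def mult.assoc intro!: sq_integrable_scale)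
  show "1 *\<^sub>R f = f"
    by transfer (auto simp: l2_rel_def)
qed

end

instantiation l2 :: real_inner
begin

lift_definition inner_l2 :: "l2 \<Rightarrow> l2 \<Rightarrow> real" is "\<lambda>f g. LINT s|lborel. f s * g s"
proof -
  fix f f' g g' assume a: "l2_rel f f'" "l2_rel g g'"
  then have "AE s in lborel. f s = f' s" "AE s in lborel. g s = g' s"
    by (auto simp: l2_rel_def)
  then have "AE s in lborel. f s * g s = f' s * g' s"
    by eventually_elim simp
  with a show "(LINT s|lborel. f s * g s) = (LINT s|lborel. f' s * g' s)"
    by (intro integral_cong_AE) (auto simp: l2_rel_def sq_integrable_def)
qed

definition norm_l2 :: "l2 \<Rightarrow> real" where "norm_l2 f = sqrt (inner f f)"
definition dist_l2 :: "l2 \<Rightarrow> l2 \<Rightarrow> real" where "dist_l2 f g = norm (f - g :: l2)"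
definition sgn_l2 :: "l2 \<Rightarrow> l2" where "sgn_l2 f = f /\<^sub>R norm f"
definition uniformity_l2 :: "(l2 \<times> l2) filter" where
  "uniformity_l2 = (INF e\<in>{0 <..}. principal {(f, g). dist f g < e})"
definition open_l2 :: "l2 set \<Rightarrow> bool" where
  "open_l2 U \<longleftrightarrow> (\<forall>f\<in>U. eventually (\<lambda>(f', g). f' = f \<longrightarrow> g \<in> U) uniformity)"

instance
proof
  fix f g h :: l2 and a :: real
  show "dist f g = norm (f - g)" by (rule dist_l2_def)
  show "sgn f = f /\<^sub>R norm f" by (rule sgn_l2_def)
  show "uniformity = (INF e\<in>{0 <..}. principal {(f :: l2, g). dist f g < e})"
    by (rule uniformity_l2_def)
  show "open U \<longleftrightarrow> (\<forall>f\<in>U. eventually (\<lambda>(f', g). f' = f \<longrightarrow> g \<in> U) uniformity)"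
    for U :: "l2 set" by (rule open_l2_def)
  show "norm f = sqrt (inner f f)" by (rule norm_l2_def)
  show "inner f g = inner g f"
    by transfer (simp add: mult.commute)
  show "inner (f + g) h = inner f h + inner g h"
    by transfer (auto simp: l2_rel_def distrib_right sq_integrable_mult)
  show "inner (a *\<^sub>R f) g = a * inner f g"
    by transfer (simp add: mult.assoc)
  show "0 \<le> inner f f"
    by transfer simp
  show "inner f f = 0 \<longleftrightarrow> f = 0"
  proof transfer
    fix f assume "l2_rel f f"
    then have "integrable lborel (\<lambda>s. f s * f s)" and f: "sq_integrable f"
      by (auto simp: l2_rel_def sq_integrable_mult)
    then have "(LINT s|lborel. f s * f s) = 0 \<longleftrightarrow> (AE s in lborel. f s * f s = 0)"
      by (intro integral_nonneg_eq_0_iff_AE) auto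
    with f show "(LINT s|lborel. f s * f s) = 0 \<longleftrightarrow> l2_rel f (\<lambda>s. 0)"
      by (simp add: l2_rel_def sq_integrable_zero)
  qed
qed

end

definition L2 :: "real \<Rightarrow> l2 set" where
  "L2 d = {y. AE s in lborel. s \<notin> {-d..0} \<longrightarrow> rep_l2 y s = 0}"

text \<open>The class of a function on \<open>[-d,0]\<close>, extended by zero; meaningful only if the
  extension is square-integrable.\<close>

definition l2_of :: "real \<Rightarrow> (real \<Rightarrow> real) \<Rightarrow> l2" where
  "l2_of d f = abs_l2 (\<lambda>s. indicator {-d..0} s * f s)"

text \<open>With \<open>M2 = \<real> \<times> L\<^sup>2(-d,0)\<close> and \<open>H = \<real> \<times> M2\<close>, the inner products are those of
  the product types.\<close>

definition M2 :: "real \<Rightarrow> (real \<times> l2) set" where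
  "M2 d = UNIV \<times> L2 d"

definition Hspace :: "real \<Rightarrow> (real \<times> real \<times> l2) set" where
  "Hspace d = UNIV \<times> M2 d"

text \<open>\<open>\<psi> \<in> C\<^sub>c\<^sup>1(-d,0)\<close> with derivative \<open>\<psi>'\<close>; testing against \<open>C\<^sub>c\<^sup>1\<close> or \<open>C\<^sub>c\<^sup>\<infinity>\<close>
  functions gives the same weak derivatives.\<close>

definition test_fun :: "real \<Rightarrow> (real \<Rightarrow> real) \<Rightarrow> (real \<Rightarrow> real) \<Rightarrow> bool" where
  "test_fun d \<psi> \<psi>' \<longleftrightarrow>
     (\<forall>s. (\<psi> has_real_derivative \<psi>' s) (at s)) \<and> continuous_on UNIV \<psi>' \<and>
     (\<exists>a b. -d < a \<and> b < 0 \<and> (\<forall>s. s \<notin> {a..b} \<longrightarrow> \<psi> s = 0))"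

definition has_weak_derivative :: "real \<Rightarrow> l2 \<Rightarrow> l2 \<Rightarrow> bool" where
  "has_weak_derivative d y z \<longleftrightarrow> z \<in> L2 d \<and>
     (\<forall>\<psi> \<psi>'. test_fun d \<psi> \<psi>' \<longrightarrow>
        (LINT s|lborel. rep_l2 y s * \<psi>' s) = - (LINT s|lborel. rep_l2 z s * \<psi> s))"

definition W12 :: "real \<Rightarrow> l2 set" where
  "W12 d = {y \<in> L2 d. \<exists>z. has_weak_derivative d y z}"

definition weak_deriv :: "real \<Rightarrow> l2 \<Rightarrow> l2" where
  "weak_deriv d y = (THE z. has_weak_derivative d y z)"

text \<open>The value at \<open>t \<in> [-d,0]\<close> of the continuous representative on \<open>[-d,0]\<close>, which every
  element of \<open>W12 d\<close> has.\<close>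

definition point_value :: "real \<Rightarrow> l2 \<Rightarrow> real \<Rightarrow> real" where
  "point_value d y t = (THE v. \<exists>f. continuous_on {-d..0} f \<and>
     (AE s in lborel. s \<in> {-d..0} \<longrightarrow> rep_l2 y s = f s) \<and> v = f t)"

definition dom_Astar :: "real \<Rightarrow> (real \<times> l2) set" where
  "dom_Astar d = {(y0, y1) \<in> M2 d. y1 \<in> W12 d \<and> point_value d y1 (-d) = 0}"

definition Astar :: "real \<Rightarrow> real \<Rightarrow> l2 \<Rightarrow> real \<times> l2 \<Rightarrow> real \<times> l2" where
  "Astar d mu_y phi = (\<lambda>(y0, y1).
     (mu_y * y0 + point_value d y1 0, - weak_deriv d y1 + y0 *\<^sub>R phi))"

definition crra :: "real \<Rightarrow> real \<Rightarrow> ereal" where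
  "crra gam c = (if gam > 1 \<and> c = 0 then -\<infinity> else ereal (c powr (1 - gam) / (1 - gam)))"

definition H_cv ::
  "real \<Rightarrow> real \<Rightarrow> real \<Rightarrow> real \<Rightarrow> real^'n \<Rightarrow> real^'n^'n \<Rightarrow> real^'n \<Rightarrow>
   real \<Rightarrow> real \<Rightarrow> real \<Rightarrow> real \<Rightarrow> real \<Rightarrow> real \<Rightarrow> real^'n \<Rightarrow> ereal" where
  "H_cv r dl k gam mu sig sig_y x0 p1 P11 P12 c B th =
     crra gam c + ereal dl * crra gam (k * B) +
     ereal ((inner th (mu - r *\<^sub>R (\<chi> i. 1)) - c - dl * B) * p1
       + 1/2 * inner th ((sig ** transpose sig) *v th) * P11
       + inner th (sig *v sig_y) * x0 * P12)"

definition hamiltonian ::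
  "real \<Rightarrow> real \<Rightarrow> real \<Rightarrow> l2 \<Rightarrow> real \<Rightarrow> real \<Rightarrow> real \<Rightarrow> real^'n \<Rightarrow> real^'n^'n \<Rightarrow> real^'n \<Rightarrow>
   real \<Rightarrow> real \<times> l2 \<Rightarrow> real \<times> real \<times> l2 \<Rightarrow> real^2^2 \<Rightarrow> ereal" where
  "hamiltonian d r mu_y phi dl k gam mu sig sig_y w x p P =
     ereal ((r + dl) * w * fst p + fst x * fst p + inner x (Astar d mu_y phi (snd p))
       + 1/2 * inner sig_y sig_y * (fst x)\<^sup>2 * P $ 2 $ 2)
     + (SUP (c, B, th) \<in> {0..} \<times> {0..} \<times> UNIV.
          H_cv r dl k gam mu sig sig_y (fst x) (fst p) (P $ 1 $ 1) (P $ 1 $ 2) c B th)"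

text \<open>\<open>S\<close> is meant to be an open subset of \<open>Hspace d\<close>, so that the gradient
  \<open>Du z = (u\<^sub>w, (u\<^sub>x\<^sub>0, u\<^sub>x\<^sub>1))\<close>, which is required to lie in \<open>Hspace d\<close>, and the
  matrix \<open>D2u z\<close> of second derivatives in \<open>(w, x\<^sub>0)\<close> are unique at each \<open>z \<in> S\<close>.
  If \<open>D2u\<close> is continuous on \<open>S\<close>, it is symmetric there by Schwarz's theorem.\<close>

definition has_gradient_on ::
  "real \<Rightarrow> (real \<times> real \<times> l2) set \<Rightarrow> (real \<times> real \<times> l2 \<Rightarrow> real) \<Rightarrow>
   (real \<times> real \<times> l2 \<Rightarrow> real \<times> real \<times> l2) \<Rightarrow> bool" where
  "has_gradient_on d S u Du \<longleftrightarrow>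
     (\<forall>z\<in>S. Du z \<in> Hspace d \<and> (u has_derivative (\<lambda>h. inner (Du z) h)) (at z within S))"

definition has_second_derivs_on ::
  "(real \<times> real \<times> l2) set \<Rightarrow> (real \<times> real \<times> l2 \<Rightarrow> real \<times> real \<times> l2) \<Rightarrow>
   (real \<times> real \<times> l2 \<Rightarrow> real^2^2) \<Rightarrow> bool" where
  "has_second_derivs_on S Du D2u \<longleftrightarrow>
     (\<forall>w x0 x1. (w, x0, x1) \<in> S \<longrightarrow>
        ((\<lambda>t. fst (Du (t, x0, x1))) has_real_derivative D2u (w, x0, x1) $ 1 $ 1) (at w) \<and>
        ((\<lambda>t. fst (Du (w, t, x1))) has_real_derivative D2u (w, x0, x1) $ 1 $ 2) (at x0) \<and>
        ((\<lambda>t. fst (snd (Du (t, x0, x1)))) has_real_derivative D2u (w, x0, x1) $ 2 $ 1) (at w) \<and>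
        ((\<lambda>t. fst (snd (Du (w, t, x1)))) has_real_derivative D2u (w, x0, x1) $ 2 $ 2) (at x0))"

definition classical_solution ::
  "real \<Rightarrow> real \<Rightarrow> real \<Rightarrow> l2 \<Rightarrow> real \<Rightarrow> real \<Rightarrow> real \<Rightarrow> real \<Rightarrow> real^'n \<Rightarrow> real^'n^'n \<Rightarrow> real^'n \<Rightarrow>
   (real \<times> real \<times> l2) set \<Rightarrow> (real \<times> real \<times> l2 \<Rightarrow> real) \<Rightarrow> bool" where
  "classical_solution d r mu_y phi dl k rho gam mu sig sig_y S u \<longleftrightarrow>
     (\<exists>Du D2u.
        has_gradient_on d S u Du \<and> continuous_on S Du \<and>
        has_second_derivs_on S Du D2u \<and> continuous_on S D2u \<and>
        (\<forall>z\<in>S. snd (Du z) \<in> dom_Astar d) \<and>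
        continuous_on S (\<lambda>z. Astar d mu_y phi (snd (Du z))) \<and>
        (\<forall>(w, x)\<in>S. ereal ((rho + dl) * u (w, x))
           - hamiltonian d r mu_y phi dl k gam mu sig sig_y w x (Du (w, x)) (D2u (w, x)) = 0))"

end

theory Submission
  imports Defs
begin

text \<open>With \<open>h\<close> the solution of $h' = -(r+\delta)h + \phi$, $h(-d)=0$, one has
  $A^*(g,gh) = g\,(\mu_y+\beta_\infty,(r+\delta)h)$, so every term of the equation depends on
  \<open>x\<^sub>1\<close> only through \<open>\<Gamma>\<close>. The supremum splits into two Legendre transforms of the power
  utility and one completed square in $\sigma^\top\theta$. Writing $V = f^\gamma\Gamma^{1-\gamma}$,
  the terms linear in \<open>x\<^sub>0\<close> cancel by the choice of $g_\infty$, those quadratic in \<open>x\<^sub>0\<close>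
  cancel against $D^2_{x_0}$, and the coefficient of \<open>V\<close> vanishes by the choice of $f_\infty$.
  That weak derivatives are unique is the fundamental lemma of the calculus of variations, and that
  \<open>h\<close> has the expected one is Fubini's theorem.\<close>

section \<open>Classes of square-integrable functions\<close>

lemma sq_integrable_rep_l2: "sq_integrable (rep_l2 y)"
  using Quotient3_rep_reflp[OF Quotient3_l2, of y] by (simp add: l2_rel_def)

lemma rep_l2_measurable [measurable]: "rep_l2 y \<in> borel_measurable lborel"
  using sq_integrable_rep_l2[of y] by (simp add: sq_integrable_def)

lemma abs_l2_rep_l2: "abs_l2 (rep_l2 y) = y"
  by (rule Quotient3_abs_rep[OF Quotient3_l2])

lemma AE_rep_l2_abs_l2:
  assumes "sq_integrable f"
  shows "AE s in lborel. rep_l2 (abs_l2 f) s = f s"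
  using rep_abs_rsp_left[OF Quotient3_l2, of f f] assms by (simp add: l2_rel_def)

lemma l2_eqI:
  assumes "AE s in lborel. rep_l2 y s = rep_l2 z s"
  shows "y = z"
  using Quotient3_rel_rep[OF Quotient3_l2, of y z] assms
  by (simp add: l2_rel_def sq_integrable_rep_l2)

text \<open>\<open>rep_l2\<close> selects some representative of a class, so linearity of
  representatives holds only up to null sets and is passed on to integrals in that form.\<close>

lemma AE_rep_l2_scaleR: "AE s in lborel. rep_l2 (c *\<^sub>R y) s = c * rep_l2 y s"
proof -
  have "c *\<^sub>R y = abs_l2 (\<lambda>s. c * rep_l2 y s)"
    using scaleR_l2.abs_eq[of "rep_l2 y" c] sq_integrable_rep_l2[of y]
    by (simp add: abs_l2_rep_l2 l2_rel_def)
  with AE_rep_l2_abs_l2[OF sq_integrable_scale[OF sq_integrable_rep_l2[of y], of c]]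
  show ?thesis by simp
qed

lemma AE_rep_l2_add: "AE s in lborel. rep_l2 (y + z) s = rep_l2 y s + rep_l2 z s"
proof -
  have "y + z = abs_l2 (\<lambda>s. rep_l2 y s + rep_l2 z s)"
    using plus_l2.abs_eq[of "rep_l2 y" "rep_l2 z"] sq_integrable_rep_l2
    by (simp add: abs_l2_rep_l2 l2_rel_def)
  with AE_rep_l2_abs_l2[OF sq_integrable_add[OF sq_integrable_rep_l2 sq_integrable_rep_l2, of y z]]
  show ?thesis by simp
qed

lemma L2_scaleR:
  assumes "y \<in> L2 d"
  shows "c *\<^sub>R y \<in> L2 d"
  using assms AE_rep_l2_scaleR[of c y] unfolding L2_def mem_Collect_eq
  by eventually_elim auto

lemma L2_add:
  assumes "y \<in> L2 d" "z \<in> L2 d"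
  shows "y + z \<in> L2 d"
  using assms AE_rep_l2_add[of y z] unfolding L2_def mem_Collect_eq
  by eventually_elim auto

lemma L2_diff:
  assumes "y \<in> L2 d" "z \<in> L2 d"
  shows "y - z \<in> L2 d"
  using L2_add[OF assms(1) L2_scaleR[OF assms(2), of "-1"]] by simp

lemma sq_integrable_bounded:
  assumes [measurable]: "f \<in> borel_measurable borel"
    and "\<And>s. s \<in> {a..b} \<Longrightarrow> \<bar>f s\<bar> \<le> C"
  shows "sq_integrable (\<lambda>s. indicator {a..b} s * f s)"
  unfolding sq_integrable_def
proof
  show "(\<lambda>s. indicator {a..b} s * f s) \<in> borel_measurable lborel" by measurable
  show "integrable lborel (\<lambda>s. (indicator {a..b} s * f s)\<^sup>2)"
  proof (rule Bochner_Integration.integrable_bound)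
    show "integrable lborel (\<lambda>s. indicator {a..b} s * C\<^sup>2)"
      by (intro integrable_mult_left) (simp add: emeasure_lborel_Icc_eq)
    show "AE s in lborel. norm ((indicator {a..b} s * f s)\<^sup>2) \<le> norm (indicator {a..b} s * C\<^sup>2)"
    proof (rule AE_I2)
      fix s
      show "norm ((indicator {a..b} s * f s)\<^sup>2) \<le> norm (indicator {a..b} s * C\<^sup>2)"
        using assms(2)[of s] power_mono[of "\<bar>f s\<bar>" C 2] by (simp add: indicator_def)
    qed
  qed measurable
qed

text \<open>The interval [-d,0] has finite length, so its indicator is square-integrable, and
  pairing with it gives integrability.\<close>

lemma integrable_rep_l2:
  assumes "y \<in> L2 d"
  shows "integrable lborel (rep_l2 y)"
proof -
  have "sq_integrable (\<lambda>s. indicator {-d..0} s * (1::real))"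
    by (rule sq_integrable_bounded[where C = 1]) auto
  from sq_integrable_mult[OF sq_integrable_rep_l2 this, of y]
  have "integrable lborel (\<lambda>s. rep_l2 y s * indicator {-d..0} s)" by simp
  moreover have "AE s in lborel. rep_l2 y s * indicator {-d..0} s = rep_l2 y s"
    using assms unfolding L2_def mem_Collect_eq by eventually_elim (auto simp: indicator_def)
  ultimately show ?thesis
    by (subst (asm) integrable_cong_AE) auto
qed

lemma integrable_rep_l2_mult_continuous:
  assumes y: "y \<in> L2 d" and q: "continuous_on UNIV q"
  shows "integrable lborel (\<lambda>s. rep_l2 y s * q s)"
proof -
  have [measurable]: "q \<in> borel_measurable borel"
    using q by (rule borel_measurable_continuous_onI)
  have "compact (q ` {-d..0})"
    using q by (intro compact_continuous_image continuous_on_subset[OF q]) auto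
  then obtain C where C: "\<And>s. s \<in> {-d..0} \<Longrightarrow> \<bar>q s\<bar> \<le> C"
    using compact_imp_bounded bounded_iff by (metis imageI real_norm_def)
  have "integrable lborel (\<lambda>s. rep_l2 y s * (indicator {-d..0} s * q s))"
    by (intro sq_integrable_mult sq_integrable_rep_l2 sq_integrable_bounded[where C = C] C) measurable
  moreover have "AE s in lborel. rep_l2 y s * (indicator {-d..0} s * q s) = rep_l2 y s * q s"
    using y unfolding L2_def mem_Collect_eq by eventually_elim (auto simp: indicator_def)
  ultimately show ?thesis
    by (subst (asm) integrable_cong_AE) auto
qed

lemma integral_rep_l2_scaleR:
  assumes [measurable]: "q \<in> borel_measurable borel"
  shows "(LINT s|lborel. rep_l2 (c *\<^sub>R y) s * q s) = c * (LINT s|lborel. rep_l2 y s * q s)"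
proof -
  have "(LINT s|lborel. rep_l2 (c *\<^sub>R y) s * q s) = (LINT s|lborel. c * (rep_l2 y s * q s))"
    using AE_rep_l2_scaleR[of c y]
    by (intro integral_cong_AE) (auto elim!: eventually_mono)
  then show ?thesis by simp
qed

lemma integral_rep_l2_add:
  assumes "y \<in> L2 d" "z \<in> L2 d" "continuous_on UNIV q"
  shows "(LINT s|lborel. rep_l2 (y + z) s * q s)
    = (LINT s|lborel. rep_l2 y s * q s) + (LINT s|lborel. rep_l2 z s * q s)"
proof -
  have [measurable]: "q \<in> borel_measurable borel"
    using assms(3) by (rule borel_measurable_continuous_onI)
  have "(LINT s|lborel. rep_l2 (y + z) s * q s) = (LINT s|lborel. rep_l2 y s * q s + rep_l2 z s * q s)"
    using AE_rep_l2_add[of y z]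
    by (intro integral_cong_AE) (auto elim!: eventually_mono simp: algebra_simps)
  then show ?thesis
    using assms by (simp add: integrable_rep_l2_mult_continuous)
qed

section \<open>Weak derivatives and point values\<close>

lemma emeasure_density_eq_integral:
  assumes g: "integrable lborel g" "\<And>s. 0 \<le> g s" and [measurable]: "A \<in> sets borel"
  shows "emeasure (density lborel (\<lambda>s. ennreal (g s))) A = ennreal (LINT s:A|lborel. g s)"
proof -
  have [measurable]: "g \<in> borel_measurable borel" using g by simp
  have "integrable lborel (\<lambda>s. indicator A s * g s)"
    by (rule Bochner_Integration.integrable_bound[OF g(1)]) (auto simp: indicator_def)
  from nn_integral_eq_integral[OF this] g(2)
  have "(\<integral>\<^sup>+s. ennreal (indicator A s * g s) \<partial>lborel) = ennreal (LINT s:A|lborel. g s)"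
    by (simp add: set_lebesgue_integral_def)
  moreover have "emeasure (density lborel (\<lambda>s. ennreal (g s))) A
      = (\<integral>\<^sup>+s. ennreal (indicator A s * g s) \<partial>lborel)"
    by (subst emeasure_density) (auto simp: indicator_def intro!: nn_integral_cong)
  ultimately show ?thesis by simp
qed

text \<open>The positive and negative parts of \<open>f\<close> are densities of two finite measures
  that agree on all half-lines, hence are equal. Their densities then agree almost everywhere, and
  the two parts of one number coincide only at 0.\<close>

lemma AE_zero_if_integral_Ioi_zero:
  fixes f :: "real \<Rightarrow> real"
  assumes f: "integrable lborel f" and zero: "\<And>x. (LINT s:{x<..}|lborel. f s) = 0"
  shows "AE s in lborel. f s = 0"
proof -
  have [measurable]: "f \<in> borel_measurable borel" using f by simp
  have pos: "integrable lborel (\<lambda>s. max 0 (f s))" and neg: "integrable lborel (\<lambda>s. max 0 (- f s))"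
    using f by auto
  have "density lborel (\<lambda>s. ennreal (max 0 (f s))) = density lborel (\<lambda>s. ennreal (max 0 (- f s)))"
  proof (rule measure_eqI_lessThan)
    fix x :: real
    have "(LINT s:{x<..}|lborel. max 0 (f s)) - (LINT s:{x<..}|lborel. max 0 (- f s))
        = (LINT s:{x<..}|lborel. max 0 (f s) - max 0 (- f s))"
      using integrable_mult_indicator[OF _ pos, of "{x<..}"] integrable_mult_indicator[OF _ neg, of "{x<..}"]
      by (intro set_integral_diff(2)[symmetric]) (auto simp: set_integrable_def)
    also have "\<dots> = (LINT s:{x<..}|lborel. f s)"
      by (intro set_lebesgue_integral_cong) auto
    finally show "emeasure (density lborel (\<lambda>s. ennreal (max 0 (f s)))) {x<..}
        = emeasure (density lborel (\<lambda>s. ennreal (max 0 (- f s)))) {x<..}"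
      using zero[of x] by (simp add: emeasure_density_eq_integral pos neg)
  qed (auto simp: emeasure_density_eq_integral pos)
  then have "AE s in lborel. ennreal (max 0 (f s)) = ennreal (max 0 (- f s))"
    by (intro sigma_finite_measure.density_unique[OF lborel.sigma_finite_measure_axioms]) auto
  then show ?thesis
    by eventually_elim (auto simp: max_def split: if_splits)
qed

text \<open>Away from 0 the function is locally t^2 or 0; at 0 its difference quotient is bounded by
  |h|.\<close>

lemma DERIV_max_zero_power2: "((\<lambda>t::real. (max 0 t)\<^sup>2) has_real_derivative 2 * max 0 t) (at t)"
proof (cases "t = 0")
  case True
  have "((\<lambda>h::real. (max 0 h)\<^sup>2 / h) \<longlongrightarrow> 0) (at 0)"
  proof (rule Lim_null_comparison)
    show "\<forall>\<^sub>F h::real in at 0. norm ((max 0 h)\<^sup>2 / h) \<le> \<bar>h\<bar>"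
      by (intro always_eventually allI) (auto simp: max_def power2_eq_square)
    show "((\<lambda>h::real. \<bar>h\<bar>) \<longlongrightarrow> 0) (at 0)"
      by (auto intro!: tendsto_eq_intros)
  qed
  then show ?thesis using True by (simp add: DERIV_def)
next
  case False
  show ?thesis
  proof (cases "t > 0")
    case True
    then have "\<forall>\<^sub>F s in nhds t. (max 0 s)\<^sup>2 = s\<^sup>2"
      using eventually_nhds_in_open[of "{0<..}" t] by (auto elim!: eventually_mono)
    moreover have "((\<lambda>s. s\<^sup>2) has_real_derivative 2 * max 0 t) (at t)"
      using True by (auto intro!: derivative_eq_intros)
    ultimately show ?thesis by (subst DERIV_cong_ev) auto
  next
    case neg: False
    with False have "t < 0" by simp
    then have "\<forall>\<^sub>F s in nhds t. (max 0 s)\<^sup>2 = 0"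
      using eventually_nhds_in_open[of "{..<0}" t] by (auto elim!: eventually_mono)
    moreover have "((\<lambda>s. 0) has_real_derivative 2 * max 0 t) (at t)"
      using \<open>t < 0\<close> by simp
    ultimately show ?thesis by (subst DERIV_cong_ev) auto
  qed
qed

text \<open>Squaring the positive part makes these functions continuously differentiable; they tend
  boundedly to the indicator of \<open>(a,b)\<close> as \<open>n \<rightarrow> \<infinity>\<close>, and the shifts by \<open>1/n\<close> keep
  for large \<open>n\<close> their supports inside \<open>(a,b)\<close>.\<close>

definition bump :: "real \<Rightarrow> real \<Rightarrow> nat \<Rightarrow> real \<Rightarrow> real" where
  "bump a b n s = (let m = (max 0 ((s - a - 1 / real n) * (b - 1 / real n - s)))\<^sup>2
     in real n * m / (1 + real n * m))"

lemma bump_bounds: "0 \<le> bump a b n s" "bump a b n s \<le> 1"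
proof -
  have "0 \<le> x / (1 + x)" "x / (1 + x) \<le> 1" if "0 \<le> x" for x :: real
    using that by (simp_all add: divide_le_eq)
  from this[of "real n * (max 0 ((s - a - 1 / real n) * (b - 1 / real n - s)))\<^sup>2"]
  show "0 \<le> bump a b n s" "bump a b n s \<le> 1"
    unfolding bump_def Let_def by auto
qed

text \<open>The bound on 2/n keeps the shifted interval nondegenerate. Outside it the two linear
  factors then cannot both be negative, so the positive part of their product vanishes
  there.\<close>

lemma bump_test_fun:
  assumes "-d \<le> a" "b \<le> 0" "n > 0" "2 / real n < b - a"
  shows "\<exists>\<psi>'. test_fun d (bump a b n) \<psi>'"
proof -
  let ?q = "\<lambda>s. (s - a - 1 / real n) * (b - 1 / real n - s)"
  let ?m = "\<lambda>s. (max 0 (?q s))\<^sup>2"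
  define \<psi>' where "\<psi>' s = real n * (2 * max 0 (?q s) * (a + b - 2 * s)) / (1 + real n * ?m s)\<^sup>2" for s
  have pos: "1 + real n * ?m s > 0" for s
    by (intro add_pos_nonneg) auto
  have dm: "(?m has_real_derivative 2 * max 0 (?q s) * (a + b - 2 * s)) (at s)" for s
  proof -
    have "(?q has_real_derivative (a + b - 2 * s)) (at s)"
      by (auto intro!: derivative_eq_intros simp: algebra_simps)
    from DERIV_chain2[OF DERIV_max_zero_power2 this] show ?thesis .
  qed
  have "(bump a b n has_real_derivative \<psi>' s) (at s)" for s
  proof -
    have "((\<lambda>s. c * m s / (1 + c * m s)) has_real_derivative c * m' / (1 + c * m s)\<^sup>2) (at s)"
      if "(m has_real_derivative m') (at s)" "1 + c * m s > 0" for c m' and m :: "real \<Rightarrow> real"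
      using that(2) by (auto intro!: derivative_eq_intros that(1) simp: field_simps power2_eq_square)
    from this[OF dm pos] show ?thesis unfolding bump_def Let_def \<psi>'_def .
  qed
  moreover have "continuous_on UNIV \<psi>'"
    unfolding \<psi>'_def using pos by (intro continuous_intros) (auto simp: less_imp_neq[symmetric])
  moreover have "bump a b n s = 0" if "s \<notin> {a + 1 / real n..b - 1 / real n}" for s
  proof -
    from that have "s < a + 1 / real n \<or> b - 1 / real n < s" by auto
    moreover have "a + 1 / real n < b - 1 / real n"
      using assms(4) by simp
    ultimately have "?q s \<le> 0"
      by (auto simp: mult_le_0_iff)
    then have "max 0 (?q s) = 0" by (rule max_absorb1)
    then show ?thesis unfolding bump_def Let_def by simp
  qed
  moreover have "-d < a + 1 / real n" "b - 1 / real n < 0"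
  proof -
    have "0 < 1 / real n" using assms(3) by simp
    with assms(1,2) show "-d < a + 1 / real n" "b - 1 / real n < 0" by linarith+
  qed
  ultimately show ?thesis
    unfolding test_fun_def by blast
qed

text \<open>Inside (a,b) the squared product has a positive limit, so n m tends to infinity and n m
  / (1 + n m) to 1. Elsewhere, endpoints included, the value is eventually exactly 0.\<close>

lemma bump_tendsto:
  "(\<lambda>n. bump a b n s) \<longlonglongrightarrow> (if a < s \<and> s < b then 1 else 0)" if "a < b"
proof (cases "a < s \<and> s < b")
  case True
  let ?m = "\<lambda>n. (max 0 ((s - a - 1 / real n) * (b - 1 / real n - s)))\<^sup>2"
  have "?m \<longlonglongrightarrow> (max 0 ((s - a - 0) * (b - 0 - s)))\<^sup>2"
    by (intro tendsto_intros lim_1_over_n)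
  moreover have "(max 0 ((s - a - 0) * (b - 0 - s)))\<^sup>2 > 0"
    using True by (auto simp: max_def)
  ultimately have "filterlim (\<lambda>n. ?m n * real n) at_top sequentially"
    by (intro filterlim_tendsto_pos_mult_at_top filterlim_real_sequentially)
  then have "filterlim (\<lambda>n. 1 + real n * ?m n) at_top sequentially"
    by (intro filterlim_tendsto_add_at_top[OF tendsto_const]) (simp add: mult.commute)
  then have "(\<lambda>n. 1 - inverse (1 + real n * ?m n)) \<longlonglongrightarrow> 1 - 0"
    by (intro tendsto_intros tendsto_inverse_0_at_top)
  moreover have "1 - inverse (1 + real n * ?m n) = bump a b n s" for n
  proof -
    have "1 + real n * ?m n > 0" by (intro add_pos_nonneg) auto
    then show ?thesis by (simp add: bump_def Let_def field_simps)
  qed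
  ultimately show ?thesis using True by simp
next
  case False
  have small: "\<forall>\<^sub>F n in sequentially. 2 / real n < b - a"
    using that by (intro order_tendstoD(2)[OF lim_const_over_n]) simp
  have "\<forall>\<^sub>F n in sequentially. bump a b n s = 0"
    using eventually_gt_at_top[of "0::nat"] small
  proof eventually_elim
    case (elim n)
    define e where "e = 1 / real n"
    from elim have "0 < e" "2 * e < b - a" by (simp_all add: e_def)
    with False have "s - a - e \<le> 0 \<and> 0 \<le> b - e - s \<or> 0 \<le> s - a - e \<and> b - e - s \<le> 0"
      by linarith
    then have "(s - a - 1 / real n) * (b - 1 / real n - s) \<le> 0"
      by (auto simp: e_def mult_le_0_iff)
    then show ?case by (simp add: bump_def max_absorb1)
  qed
  with False show ?thesis
    by (simp only: if_False tendsto_eventually)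
qed

lemma test_fun_continuous:
  assumes "test_fun d \<psi> \<psi>'"
  shows "continuous_on UNIV \<psi>" "continuous_on UNIV \<psi>'"
  using assms by (auto simp: test_fun_def intro!: DERIV_continuous_on)

text \<open>Dominated convergence along the bumps carries orthogonality over to indicators of
  intervals (a,0), and the integrals over half-lines determine \<open>y\<close>.\<close>

lemma test_fun_orthogonal_imp_AE_zero:
  assumes "d > 0" "y \<in> L2 d"
    and orth: "\<And>\<psi> \<psi>'. test_fun d \<psi> \<psi>' \<Longrightarrow> (LINT s|lborel. rep_l2 y s * \<psi> s) = 0"
  shows "AE s in lborel. rep_l2 y s = 0"
proof (rule AE_zero_if_integral_Ioi_zero[OF integrable_rep_l2[OF assms(2)]])
  fix x :: real
  note y = integrable_rep_l2[OF assms(2)]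
  have supp: "AE s in lborel. s \<notin> {-d..0} \<longrightarrow> rep_l2 y s = 0"
    using assms(2) by (simp add: L2_def)
  \<comment> \<open>As \<open>y\<close> vanishes outside [-d,0], the half-line above
    \<open>x\<close> may be cut down to (a,0), up to null sets.\<close>
  define a where "a = max x (-d)"
  show "(LINT s:{x<..}|lborel. rep_l2 y s) = 0"
  proof (cases "a < 0")
    case True
    have small: "\<forall>\<^sub>F n in sequentially. 2 / real n < 0 - a"
      using True by (intro order_tendstoD(2)[OF lim_const_over_n]) simp
    have "(\<lambda>n. LINT s|lborel. rep_l2 y s * bump a 0 n s) \<longlonglongrightarrow>
        (LINT s|lborel. rep_l2 y s * (if a < s \<and> s < 0 then 1 else 0))"
    proof (rule integral_dominated_convergence[where w = "\<lambda>s. norm (rep_l2 y s)"])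
      show "(\<lambda>s. rep_l2 y s * bump a 0 n s) \<in> borel_measurable lborel" for n
        unfolding bump_def Let_def by measurable
      show "AE s in lborel. (\<lambda>n. rep_l2 y s * bump a 0 n s) \<longlonglongrightarrow>
          rep_l2 y s * (if a < s \<and> s < 0 then 1 else 0)"
        by (intro AE_I2 tendsto_mult tendsto_const bump_tendsto True)
      show "AE s in lborel. norm (rep_l2 y s * bump a 0 n s) \<le> norm (rep_l2 y s)" for n
        using bump_bounds[of a 0 n] by (intro AE_I2) (simp add: abs_mult mult_left_le)
    qed (use y in auto)
    moreover have "\<forall>\<^sub>F n in sequentially. (LINT s|lborel. rep_l2 y s * bump a 0 n s) = 0"
      using eventually_gt_at_top[of "0::nat"] small
    proof eventually_elim
      case (elim n)
      have "-d \<le> a" by (simp add: a_def)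
      with elim bump_test_fun[of d a 0 n] True orth show ?case by auto
    qed
    ultimately have "(LINT s|lborel. rep_l2 y s * (if a < s \<and> s < 0 then 1 else 0)) = 0"
      by (rule LIMSEQ_unique[OF _ tendsto_eventually])
    moreover have "AE s in lborel. rep_l2 y s * (if a < s \<and> s < 0 then 1 else 0)
        = indicator {x<..} s *\<^sub>R rep_l2 y s"
      using supp AE_lborel_singleton[of "-d"] AE_lborel_singleton[of "0::real"]
      by eventually_elim (auto simp: a_def indicator_def)
    ultimately show ?thesis
      unfolding set_lebesgue_integral_def
      by (subst (asm) integral_cong_AE) auto
  next
    case False
    then have "x \<ge> 0" using assms(1) by (simp add: a_def)
    from supp have "AE s in lborel. indicator {x<..} s *\<^sub>R rep_l2 y s = 0"
      by eventually_elim (use \<open>x \<ge> 0\<close> in \<open>auto simp: indicator_def\<close>)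
    then show ?thesis
      unfolding set_lebesgue_integral_def by (rule integral_eq_zero_AE)
  qed
qed

section \<open>Uniqueness of weak derivatives and of point values\<close>

lemma weak_deriv_eqI:
  assumes "d > 0" "has_weak_derivative d y z"
  shows "weak_deriv d y = z"
proof -
  have "z' = z" if z': "has_weak_derivative d y z'" for z'
  proof -
    have L: "z \<in> L2 d" "z' \<in> L2 d" using assms(2) z' by (auto simp: has_weak_derivative_def)
    \<comment> \<open>The difference of two weak derivatives is orthogonal to every test function,
      because both pairings equal minus that of \<open>y\<close> with \<psi>'.\<close>
    have "AE s in lborel. rep_l2 (z' - z) s = 0"
    proof (rule test_fun_orthogonal_imp_AE_zero[OF assms(1) L2_diff[OF L(2,1)]])
      fix \<psi> \<psi>' assume \<psi>: "test_fun d \<psi> \<psi>'"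
      note cont = test_fun_continuous(1)[OF \<psi>]
      have "(LINT s|lborel. rep_l2 (z' - z) s * \<psi> s)
          = (LINT s|lborel. rep_l2 z' s * \<psi> s) - (LINT s|lborel. rep_l2 z s * \<psi> s)"
        using integral_rep_l2_add[OF L(2) L2_scaleR[OF L(1)] cont, of "-1"] cont
          integral_rep_l2_scaleR[OF borel_measurable_continuous_onI, of \<psi> "-1" z]
        by simp
      also have "\<dots> = 0"
      proof -
        have "- (LINT s|lborel. rep_l2 z s * \<psi> s) = - (LINT s|lborel. rep_l2 z' s * \<psi> s)"
          using assms(2) z' \<psi> unfolding has_weak_derivative_def by (metis (no_types))
        then show ?thesis by simp
      qed
      finally show "(LINT s|lborel. rep_l2 (z' - z) s * \<psi> s) = 0" .
    qed
    then have "AE s in lborel. rep_l2 z' s = rep_l2 z s"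
      using AE_rep_l2_add[of z' "(-1) *\<^sub>R z"] AE_rep_l2_scaleR[of "-1" z]
      by eventually_elim simp
    then show "z' = z" by (rule l2_eqI)
  qed
  with assms(2) show ?thesis unfolding weak_deriv_def by blast
qed

lemma has_weak_derivative_scaleR:
  assumes "has_weak_derivative d y z"
  shows "has_weak_derivative d (c *\<^sub>R y) (c *\<^sub>R z)"
  unfolding has_weak_derivative_def
proof (intro conjI allI impI)
  show "c *\<^sub>R z \<in> L2 d" using assms by (simp add: has_weak_derivative_def L2_scaleR)
  fix \<psi> \<psi>' assume \<psi>: "test_fun d \<psi> \<psi>'"
  then have "(LINT s|lborel. rep_l2 y s * \<psi>' s) = - (LINT s|lborel. rep_l2 z s * \<psi> s)"
    using assms unfolding has_weak_derivative_def by blast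
  then show "(LINT s|lborel. rep_l2 (c *\<^sub>R y) s * \<psi>' s) = - (LINT s|lborel. rep_l2 (c *\<^sub>R z) s * \<psi> s)"
    using test_fun_continuous[OF \<psi>, THEN borel_measurable_continuous_onI]
    by (simp add: integral_rep_l2_scaleR)
qed

text \<open>The set of equality is closed and contains almost all of the open interval, hence all of
  it and its closure. Reaching the endpoints matters, since the operator and its domain evaluate at
  0 and at -d.\<close>

lemma continuous_on_AE_eq_imp_eq:
  fixes f g :: "real \<Rightarrow> real"
  assumes "a < b" and f: "continuous_on {a..b} f" and g: "continuous_on {a..b} g"
    and ae: "AE s in lborel. s \<in> {a..b} \<longrightarrow> f s = g s" and "t \<in> {a..b}"
  shows "f t = g t"
proof -
  let ?C = "{s \<in> {a..b}. f s - g s = 0}"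
  have closed: "closed ?C"
    by (intro continuous_closed_preimage_constant continuous_on_diff f g) auto
  have "AE s\<in>{a<..<b} in lebesgue. s \<in> ?C"
    by (rule AE_completion) (use ae in \<open>auto elim!: eventually_mono\<close>)
  then have "{a<..<b} \<subseteq> ?C"
    using mem_closed_if_AE_lebesgue_open[OF open_greaterThanLessThan closed] by blast
  then have "closure {a<..<b} \<subseteq> ?C"
    by (rule closure_minimal[OF _ closed])
  then show ?thesis using assms(1,5) by auto
qed

text \<open>Resolves the definite description: two continuous representatives agree almost
  everywhere on [-d,0], hence everywhere there.\<close>

lemma point_value_eqI:
  assumes "d > 0" "t \<in> {-d..0}" "continuous_on {-d..0} f"
    and "AE s in lborel. s \<in> {-d..0} \<longrightarrow> rep_l2 y s = f s"
  shows "point_value d y t = f t"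
  unfolding point_value_def
proof (rule the_equality)
  show "\<exists>g. continuous_on {-d..0} g \<and> (AE s in lborel. s \<in> {-d..0} \<longrightarrow> rep_l2 y s = g s) \<and> f t = g t"
    using assms by blast
next
  fix v
  assume "\<exists>g. continuous_on {-d..0} g \<and> (AE s in lborel. s \<in> {-d..0} \<longrightarrow> rep_l2 y s = g s) \<and> v = g t"
  then obtain g where g: "continuous_on {-d..0} g"
    "AE s in lborel. s \<in> {-d..0} \<longrightarrow> rep_l2 y s = g s" "v = g t" by blast
  from assms(4) g(2) have "AE s in lborel. s \<in> {-d..0} \<longrightarrow> g s = f s"
    by eventually_elim auto
  with continuous_on_AE_eq_imp_eq[of "-d" 0 g f t] assms g show "v = f t" by auto
qed

section \<open>Integration by parts and the weak derivative of h\<close>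

lemma lborel_integrable_mult_pair:
  fixes u w :: "real \<Rightarrow> real"
  assumes "integrable lborel u" "integrable lborel w"
  shows "integrable (lborel \<Otimes>\<^sub>M lborel) (\<lambda>(s, t). u s * w t)"
proof (rule lborel_pair.Fubini_integrable)
  have [measurable]: "u \<in> borel_measurable borel" "w \<in> borel_measurable borel"
    using assms by simp_all
  show "(\<lambda>(s, t). u s * w t) \<in> borel_measurable (lborel \<Otimes>\<^sub>M lborel)" by measurable
  show "integrable lborel (\<lambda>s. LINT t|lborel. norm (case (s, t) of (s, t) \<Rightarrow> u s * w t))"
    using assms by (simp add: abs_mult)
  show "AE s in lborel. integrable lborel (\<lambda>t. case (s, t) of (s, t) \<Rightarrow> u s * w t)"
    using assms by simp
qed

text \<open>As \<open>w\<close> is merely integrable, its indefinite integral need not be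
  differentiable everywhere, so the pointwise product rule does not apply. Fubini on the triangle a
  <= t <= s <= b replaces it: the inner integral of \<open>q'\<close> over [t,b] is q(b) - q(t) = -
  q(t).\<close>

lemma integral_by_parts_indefinite:
  fixes w q q' :: "real \<Rightarrow> real"
  assumes w: "integrable lborel w"
    and q: "\<And>s. (q has_real_derivative q' s) (at s)" and q': "continuous_on UNIV q'"
    and "q b = 0"
  shows "(LINT s:{a..b}|lborel. (LINT t:{a..s}|lborel. w t) * q' s) = - (LINT t:{a..b}|lborel. w t * q t)"
proof -
  have [measurable]: "w \<in> borel_measurable borel" using w by simp
  have [measurable]: "q' \<in> borel_measurable borel" using q' by (rule borel_measurable_continuous_onI)
  \<comment> \<open>The triangle is built into the integrand, so both iterated integrals run over
    the whole line; a product of integrable functions dominates it.\<close>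
  let ?F = "\<lambda>s t. if a \<le> t \<and> t \<le> s \<and> s \<le> b then w t * q' s else 0"
  have "integrable lborel (\<lambda>s. indicator {a..b} s * q' s)"
    using borel_integrable_atLeastAtMost'[OF continuous_on_subset[OF q'], of a b]
    by (simp add: set_integrable_def)
  then have bound: "integrable (lborel \<Otimes>\<^sub>M lborel) (\<lambda>(s, t). indicator {a..b} s * q' s * w t)"
    using w by (rule lborel_integrable_mult_pair)
  have F: "integrable (lborel \<Otimes>\<^sub>M lborel) (\<lambda>(s, t). ?F s t)"
  proof (rule Bochner_Integration.integrable_bound[OF bound])
    show "AE p in lborel \<Otimes>\<^sub>M lborel. norm (case p of (s, t) \<Rightarrow> ?F s t)
        \<le> norm (case p of (s, t) \<Rightarrow> indicator {a..b} s * q' s * w t)"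
      by (intro AE_I2) (auto simp: indicator_def abs_mult)
  qed measurable
  have "(LINT s:{a..b}|lborel. (LINT t:{a..s}|lborel. w t) * q' s) = (LINT s|lborel. LINT t|lborel. ?F s t)"
    unfolding set_lebesgue_integral_def
  proof (intro Bochner_Integration.integral_cong refl)
    fix s
    have "?F s t = (indicator {a..b} s * q' s) * (indicator {a..s} t *\<^sub>R w t)" for t
      by (auto simp: indicator_def)
    then have "(LINT t|lborel. ?F s t)
        = (indicator {a..b} s * q' s) * (LINT t|lborel. indicator {a..s} t *\<^sub>R w t)"
      by (simp only: integral_mult_right_zero)
    then show "indicator {a..b} s *\<^sub>R ((LINT t|lborel. indicator {a..s} t *\<^sub>R w t) * q' s)
        = (LINT t|lborel. ?F s t)"
      by simp
  qed
  also have "\<dots> = (LINT t|lborel. LINT s|lborel. ?F s t)"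
    using lborel_pair.integral_fst[OF F] lborel_pair.integral_snd[OF F] by simp
  also have "\<dots> = (LINT t:{a..b}|lborel. - (w t * q t))"
    unfolding set_lebesgue_integral_def
  proof (intro Bochner_Integration.integral_cong refl)
    fix t
    have "?F s t = indicator {a..b} t * w t * (indicator {t..b} s *\<^sub>R q' s)" for s
      by (auto simp: indicator_def)
    then have "(LINT s|lborel. ?F s t) = indicator {a..b} t * w t * (LINT s|lborel. indicator {t..b} s *\<^sub>R q' s)"
      by simp
    also have "\<dots> = indicator {a..b} t *\<^sub>R (- (w t * q t))"
    proof (cases "t \<in> {a..b}")
      case True
      have "(LINT s|lborel. indicator {t..b} s *\<^sub>R q' s) = q b - q t"
        using True q q'
        by (intro integral_FTC_atLeastAtMost)
          (auto intro: continuous_on_subset has_field_derivative_at_within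
            simp: has_real_derivative_iff_has_vector_derivative[symmetric])
      with assms(4) show ?thesis by simp
    qed simp
    finally show "(LINT s|lborel. ?F s t) = indicator {a..b} t *\<^sub>R (- (w t * q t))" .
  qed
  finally show ?thesis by (simp add: set_lebesgue_integral_def)
qed

text \<open>The solution of $h' = -\alpha h + \phi$ on $[-d,0]$ with $h(-d)=0$.\<close>

definition duhamel :: "real \<Rightarrow> real \<Rightarrow> l2 \<Rightarrow> real \<Rightarrow> real" where
  "duhamel d \<alpha> \<phi> s = (LINT t:{-d..s}|lborel. exp (- \<alpha> * (s - t)) * rep_l2 \<phi> t)"

text \<open>Separating the variables leaves an exponential times an indefinite integral, the form in
  which continuity and integration by parts are available.\<close>

lemma duhamel_eq:
  "duhamel d \<alpha> \<phi> s = exp (- \<alpha> * s) * (LINT t:{-d..s}|lborel. rep_l2 \<phi> t * exp (\<alpha> * t))"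
proof -
  have "exp (- \<alpha> * (s - t)) * rep_l2 \<phi> t = exp (- \<alpha> * s) * (rep_l2 \<phi> t * exp (\<alpha> * t))" for t
    by (simp add: exp_add[symmetric] algebra_simps)
  then show ?thesis unfolding duhamel_def by (simp only: set_integral_mult_right)
qed

lemma duhamel_initial: "duhamel d \<alpha> \<phi> (-d) = 0"
proof -
  have "AE t in lborel. indicator {-d} t *\<^sub>R (exp (- \<alpha> * (-d - t)) * rep_l2 \<phi> t) = 0"
    using AE_lborel_singleton[of "-d"] by eventually_elim simp
  then show ?thesis
    by (simp add: duhamel_def set_lebesgue_integral_def integral_eq_zero_AE)
qed

lemma duhamel_zero: "duhamel d \<alpha> \<phi> 0 = (LINT s:{-d..0}|lborel. exp (\<alpha> * s) * rep_l2 \<phi> s)"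
  by (simp add: duhamel_def)

lemma continuous_on_duhamel:
  assumes "\<phi> \<in> L2 d"
  shows "continuous_on {-d..0} (duhamel d \<alpha> \<phi>)"
proof -
  let ?w = "\<lambda>t. rep_l2 \<phi> t * exp (\<alpha> * t)"
  have w: "integrable lborel ?w"
    using assms by (intro integrable_rep_l2_mult_continuous continuous_intros)
  have set: "set_integrable lborel A ?w" if "A \<in> sets borel" for A
    using w that unfolding set_integrable_def
    by (intro integrable_mult_indicator) auto
  have "continuous_on {-d..0} (\<lambda>s. integral {-d..s} ?w)"
    by (intro indefinite_integral_continuous_1 set_borel_integral_eq_integral(1) set) auto
  then show ?thesis
    unfolding duhamel_eq[abs_def]
    by (auto simp: set_borel_integral_eq_integral(2)[OF set] intro!: continuous_intros)
qed

lemma sq_integrable_duhamel: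
  assumes "\<phi> \<in> L2 d"
  shows "sq_integrable (\<lambda>s. indicator {-d..0} s * duhamel d \<alpha> \<phi> s)"
proof -
  note cont = continuous_on_duhamel[OF assms, of \<alpha>]
  obtain C where C: "\<And>s. s \<in> {-d..0} \<Longrightarrow> \<bar>duhamel d \<alpha> \<phi> s\<bar> \<le> C"
    using compact_imp_bounded[OF compact_continuous_image[OF cont]] bounded_iff
    by (metis imageI real_norm_def compact_Icc)
  have "(\<lambda>s. indicator {-d..0} s *\<^sub>R duhamel d \<alpha> \<phi> s) \<in> borel_measurable borel"
    by (rule borel_measurable_continuous_on_indicator[OF _ cont]) simp
  \<comment> \<open>The indicator is doubled because \<open>sq_integrable_bounded\<close> asks for a
    Borel function on the whole line, while continuity on [-d,0] yields measurability only of the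
    function cut off there.\<close>
  then have "sq_integrable (\<lambda>s. indicator {-d..0} s * (indicator {-d..0} s * duhamel d \<alpha> \<phi> s))"
    by (intro sq_integrable_bounded[where C = C]) (auto simp: C)
  moreover have "(\<lambda>s. indicator {-d..0} s * (indicator {-d..0} s * duhamel d \<alpha> \<phi> s))
      = (\<lambda>s. indicator {-d..0} s * duhamel d \<alpha> \<phi> s)"
    by (auto simp: indicator_def)
  ultimately show ?thesis by simp
qed

lemma l2_of_scale:
  assumes "sq_integrable (\<lambda>s. indicator {-d..0} s * f s)"
  shows "l2_of d (\<lambda>s. c * f s) = c *\<^sub>R l2_of d f"
  unfolding l2_of_def using assms
  by (subst scaleR_l2.abs_eq) (simp_all add: l2_rel_def mult_ac)

lemma AE_rep_l2_of:
  assumes "sq_integrable (\<lambda>s. indicator {-d..0} s * f s)"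
  shows "AE s in lborel. rep_l2 (l2_of d f) s = indicator {-d..0} s * f s"
  unfolding l2_of_def using assms by (rule AE_rep_l2_abs_l2)

lemma l2_of_in_L2:
  assumes "sq_integrable (\<lambda>s. indicator {-d..0} s * f s)"
  shows "l2_of d f \<in> L2 d"
  using AE_rep_l2_of[OF assms] unfolding L2_def mem_Collect_eq
  by eventually_elim auto

text \<open>With the \<alpha> term moved to the left, h is paired with \<psi>' - \<alpha> \<psi>.
  Times exp(-\<alpha> s) this is the derivative of exp(-\<alpha> s) \<psi>, so integration by parts
  applies to the indefinite integral of \<phi> exp(\<alpha> t), and the exponentials cancel.\<close>

lemma has_weak_derivative_duhamel:
  assumes "\<phi> \<in> L2 d"
  shows "has_weak_derivative d (l2_of d (duhamel d \<alpha> \<phi>)) (\<phi> + (- \<alpha>) *\<^sub>R l2_of d (duhamel d \<alpha> \<phi>))"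
  unfolding has_weak_derivative_def
proof (intro conjI allI impI)
  let ?h = "l2_of d (duhamel d \<alpha> \<phi>)"
  note sq = sq_integrable_duhamel[OF assms, of \<alpha>]
  note hL = l2_of_in_L2[OF sq]
  show "\<phi> + (- \<alpha>) *\<^sub>R ?h \<in> L2 d"
    by (intro L2_add L2_scaleR assms hL)
  fix \<psi> \<psi>' assume \<psi>: "test_fun d \<psi> \<psi>'"
  note cont = test_fun_continuous[OF \<psi>]
  note [measurable] = cont[THEN borel_measurable_continuous_onI]
  let ?w = "\<lambda>t. rep_l2 \<phi> t * exp (\<alpha> * t)"
  let ?q = "\<lambda>s. exp (- \<alpha> * s) * \<psi> s"
  let ?q' = "\<lambda>s. exp (- \<alpha> * s) * \<psi>' s - \<alpha> * (exp (- \<alpha> * s) * \<psi> s)"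
  have "(LINT s|lborel. rep_l2 ?h s * \<psi>' s) - \<alpha> * (LINT s|lborel. rep_l2 ?h s * \<psi> s)
      = (LINT s|lborel. rep_l2 ?h s * \<psi>' s - \<alpha> * (rep_l2 ?h s * \<psi> s))"
    using integrable_rep_l2_mult_continuous[OF hL] cont by simp
  also have "\<dots> = (LINT s:{-d..0}|lborel. (LINT t:{-d..s}|lborel. ?w t) * ?q' s)"
  proof -
    have eq: "indicator {-d..0} s *\<^sub>R ((LINT t:{-d..s}|lborel. ?w t) * ?q' s)
        = (indicator {-d..0} s * duhamel d \<alpha> \<phi> s) * (\<psi>' s - \<alpha> * \<psi> s)" for s
      unfolding duhamel_eq by (simp add: algebra_simps)
    have "AE s in lborel. rep_l2 ?h s * \<psi>' s - \<alpha> * (rep_l2 ?h s * \<psi> s)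
        = indicator {-d..0} s *\<^sub>R ((LINT t:{-d..s}|lborel. ?w t) * ?q' s)"
      using AE_rep_l2_of[OF sq] unfolding eq
      by eventually_elim (simp add: algebra_simps)
    moreover have "(\<lambda>s. indicator {-d..0} s *\<^sub>R ((LINT t:{-d..s}|lborel. ?w t) * ?q' s)) \<in> borel_measurable lborel"
    proof -
      have [measurable]: "(\<lambda>s. indicator {-d..0} s * duhamel d \<alpha> \<phi> s) \<in> borel_measurable borel"
        using sq by (simp add: sq_integrable_def)
      show ?thesis unfolding eq by measurable
    qed
    ultimately show ?thesis
      unfolding set_lebesgue_integral_def[of lborel "{-d..0}"] by (intro integral_cong_AE) auto
  qed
  also have "\<dots> = - (LINT t:{-d..0}|lborel. ?w t * ?q t)"
  proof (rule integral_by_parts_indefinite)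
    show "integrable lborel ?w"
      using assms by (intro integrable_rep_l2_mult_continuous continuous_intros)
    show "(?q has_real_derivative ?q' s) (at s)" for s
      using \<psi> by (auto simp: test_fun_def algebra_simps intro!: derivative_eq_intros)
    show "continuous_on UNIV ?q'"
      by (intro continuous_intros cont)
    show "?q 0 = 0"
      using \<psi> by (auto simp: test_fun_def)
  qed
  also have "(LINT t:{-d..0}|lborel. ?w t * ?q t) = (LINT t|lborel. rep_l2 \<phi> t * \<psi> t)"
    unfolding set_lebesgue_integral_def
  proof (rule integral_cong_AE)
    show "AE t in lborel. indicator {-d..0} t *\<^sub>R (?w t * ?q t) = rep_l2 \<phi> t * \<psi> t"
      using assms unfolding L2_def mem_Collect_eq
      by eventually_elim (auto simp: indicator_def exp_minus)
  qed measurable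
  finally have "(LINT s|lborel. rep_l2 ?h s * \<psi>' s)
      = - ((LINT s|lborel. rep_l2 \<phi> s * \<psi> s) + (- \<alpha>) * (LINT s|lborel. rep_l2 ?h s * \<psi> s))"
    by simp
  also have "\<dots> = - (LINT s|lborel. rep_l2 (\<phi> + (- \<alpha>) *\<^sub>R ?h) s * \<psi> s)"
    by (subst integral_rep_l2_add[OF assms L2_scaleR[OF hL] cont(1)], subst integral_rep_l2_scaleR) auto
  finally show "(LINT s|lborel. rep_l2 ?h s * \<psi>' s) = - (LINT s|lborel. rep_l2 (\<phi> + (- \<alpha>) *\<^sub>R ?h) s * \<psi> s)" .
qed

lemma point_value_duhamel:
  assumes "d > 0" "\<phi> \<in> L2 d" "t \<in> {-d..0}"
  shows "point_value d (c *\<^sub>R l2_of d (duhamel d \<alpha> \<phi>)) t = c * duhamel d \<alpha> \<phi> t"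
proof (rule point_value_eqI[OF assms(1,3)])
  show "continuous_on {-d..0} (\<lambda>t. c * duhamel d \<alpha> \<phi> t)"
    by (intro continuous_intros continuous_on_duhamel assms)
  show "AE s in lborel. s \<in> {-d..0} \<longrightarrow> rep_l2 (c *\<^sub>R l2_of d (duhamel d \<alpha> \<phi>)) s = c * duhamel d \<alpha> \<phi> s"
    using AE_rep_l2_scaleR[of c "l2_of d (duhamel d \<alpha> \<phi>)"] AE_rep_l2_of[OF sq_integrable_duhamel[OF assms(2), of \<alpha>]]
    by eventually_elim simp
qed

section \<open>The operator \<open>Astar\<close> on multiples of h\<close>

lemma duhamel_in_dom_Astar:
  assumes "d > 0" "\<phi> \<in> L2 d"
  shows "(y0, c *\<^sub>R l2_of d (duhamel d \<alpha> \<phi>)) \<in> dom_Astar d"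
proof -
  have "c *\<^sub>R l2_of d (duhamel d \<alpha> \<phi>) \<in> L2 d"
    by (intro L2_scaleR l2_of_in_L2 sq_integrable_duhamel assms)
  moreover have "\<exists>z. has_weak_derivative d (c *\<^sub>R l2_of d (duhamel d \<alpha> \<phi>)) z"
    using has_weak_derivative_scaleR[OF has_weak_derivative_duhamel[OF assms(2)]] by blast
  moreover have "point_value d (c *\<^sub>R l2_of d (duhamel d \<alpha> \<phi>)) (-d) = 0"
    using assms by (simp add: point_value_duhamel duhamel_initial)
  ultimately show ?thesis by (simp add: dom_Astar_def M2_def W12_def)
qed

text \<open>The weak derivative contributes -c (\<phi> - \<alpha> h) and the first component c
  \<phi>, so \<phi> drops out. What remains is \<open>c\<close> times a fixed vector, so continuity
  along the gradient reduces to that of a scalar.\<close>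

lemma Astar_duhamel:
  assumes "d > 0" "\<phi> \<in> L2 d"
  shows "Astar d m \<phi> (c, c *\<^sub>R l2_of d (duhamel d \<alpha> \<phi>))
    = c *\<^sub>R (m + duhamel d \<alpha> \<phi> 0, \<alpha> *\<^sub>R l2_of d (duhamel d \<alpha> \<phi>))"
proof -
  have "weak_deriv d (c *\<^sub>R l2_of d (duhamel d \<alpha> \<phi>))
      = c *\<^sub>R (\<phi> + (- \<alpha>) *\<^sub>R l2_of d (duhamel d \<alpha> \<phi>))"
    by (intro weak_deriv_eqI has_weak_derivative_scaleR has_weak_derivative_duhamel assms)
  then show ?thesis
    using assms by (simp add: Astar_def point_value_duhamel algebra_simps)
qed

section \<open>Maximization of the Hamiltonian\<close>

text \<open>For these \<alpha> the function t^\<alpha>/\<alpha> is concave, hence lies below its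
  tangent at 1.\<close>

lemma powr_tangent_at_one:
  fixes t \<alpha> :: real
  assumes "t > 0" "\<alpha> < 1" "\<alpha> \<noteq> 0"
  shows "t powr \<alpha> / \<alpha> \<le> t - 1 + 1 / \<alpha>"
proof (cases "\<alpha> < 0")
  case True
  have "1 + \<alpha> * (t - 1) \<le> 1 + \<alpha> * ln t"
    using ln_le_minus_one[OF assms(1)] True by (simp add: mult_le_cancel_left)
  also have "\<dots> \<le> t powr \<alpha>"
    using exp_ge_add_one_self[of "\<alpha> * ln t"] assms(1) by (simp add: powr_def)
  finally show ?thesis using True by (simp add: field_simps)
next
  case False
  with assms have \<alpha>: "0 < \<alpha>" "\<alpha> < 1" by auto
  \<comment> \<open>The weights make the logarithms cancel. With 1 + x <= exp x and a factor
    t^\<alpha>, this becomes the weighted arithmetic-geometric mean inequality.\<close>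
  have "1 = \<alpha> * (1 + (1 - \<alpha>) * ln t) + (1 - \<alpha>) * (1 + (- \<alpha>) * ln t)"
    by (simp add: algebra_simps)
  also have "\<dots> \<le> \<alpha> * t powr (1 - \<alpha>) + (1 - \<alpha>) * t powr (- \<alpha>)"
    using exp_ge_add_one_self[of "(1 - \<alpha>) * ln t"] exp_ge_add_one_self[of "(- \<alpha>) * ln t"] assms(1) \<alpha>
    by (intro add_mono mult_left_mono) (auto simp: powr_def)
  finally have "t powr \<alpha> \<le> t powr \<alpha> * (\<alpha> * t powr (1 - \<alpha>) + (1 - \<alpha>) * t powr (- \<alpha>))"
    using mult_left_mono[of 1 _ "t powr \<alpha>"] by simp
  also have "\<dots> = \<alpha> * (t powr \<alpha> * t powr (1 - \<alpha>)) + (1 - \<alpha>) * (t powr \<alpha> * t powr (- \<alpha>))"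
    by (simp add: algebra_simps)
  also have "\<dots> = \<alpha> * t + (1 - \<alpha>)"
    using assms(1) by (simp add: powr_add[symmetric])
  finally show ?thesis using \<alpha> by (simp add: field_simps)
qed

text \<open>The right side is the tangent of the concave utility at \<open>q\<close>, rescaled from
  the tangent at 1 by t = c/q. At c = 0 the utility is -infinity for gam > 1, and 0 for gam < 1,
  where the intercept is positive.\<close>

lemma crra_le_tangent:
  assumes gam: "gam > 0" "gam \<noteq> 1" and "q > 0" "c \<ge> 0"
  shows "crra gam c \<le> ereal (c * q powr (- gam) + gam / (1 - gam) * q powr (1 - gam))"
proof (cases "c = 0")
  case True
  with assms show ?thesis by (auto simp: crra_def)
next
  case False
  with assms have "c > 0" by simp
  have "c powr (1 - gam) / (1 - gam) = q powr (1 - gam) * ((c / q) powr (1 - gam) / (1 - gam))"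
    using \<open>c > 0\<close> \<open>q > 0\<close> by (simp add: powr_divide)
  also have "\<dots> \<le> q powr (1 - gam) * (c / q - 1 + 1 / (1 - gam))"
    using powr_tangent_at_one[of "c / q" "1 - gam"] \<open>c > 0\<close> assms by (intro mult_left_mono) auto
  also have "\<dots> = c * (q powr (1 - gam) / q) + gam / (1 - gam) * q powr (1 - gam)"
    using assms by (simp add: field_simps)
  also have "q powr (1 - gam) / q = q powr (- gam)"
    using assms by (simp add: powr_diff powr_minus field_simps)
  finally show ?thesis using \<open>c > 0\<close> by (simp add: crra_def)
qed

lemma crra_eq_tangent:
  assumes "gam > 0" "gam \<noteq> 1" "q > 0"
  shows "crra gam q = ereal (q * q powr (- gam) + gam / (1 - gam) * q powr (1 - gam))"
proof -
  have "q * q powr (- gam) = q powr (1 - gam)"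
    using assms by (simp add: powr_diff powr_minus field_simps)
  then show ?thesis using assms by (simp add: crra_def field_simps)
qed

lemma inner_matrix_vector_mult:
  fixes A :: "real^'n^'m"
  shows "inner x (A *v y) = inner (transpose A *v x) y"
  by (metis dot_lmul_matrix transpose_matrix_vector)

text \<open>Completing the square; the maximizer is \<eta> = a/gam, the point used in
  \<open>inner_concave_eq\<close>.\<close>

lemma inner_concave_le:
  fixes \<eta> a :: "'a::real_inner"
  assumes "gam > 0"
  shows "inner \<eta> a - gam / 2 * inner \<eta> \<eta> \<le> inner a a / (2 * gam)"
proof -
  have "0 \<le> inner (\<eta> - (1 / gam) *\<^sub>R a) (\<eta> - (1 / gam) *\<^sub>R a)" by simp
  also have "\<dots> = inner \<eta> \<eta> - 2 / gam * inner \<eta> a + inner a a / gam\<^sup>2"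
    by (simp add: inner_diff inner_commute power2_eq_square algebra_simps)
  finally have "0 \<le> gam / 2 * (inner \<eta> \<eta> - 2 / gam * inner \<eta> a + inner a a / gam\<^sup>2)"
    using assms by simp
  also have "\<dots> = gam / 2 * inner \<eta> \<eta> - inner \<eta> a + inner a a / (2 * gam)"
    using assms by (simp add: field_simps power2_eq_square)
  finally show ?thesis by simp
qed

lemma inner_concave_eq:
  fixes a :: "'a::real_inner"
  assumes "gam > 0"
  shows "inner ((1 / gam) *\<^sub>R a) a - gam / 2 * inner ((1 / gam) *\<^sub>R a) ((1 / gam) *\<^sub>R a)
    = inner a a / (2 * gam)"
  using assms by (simp add: field_simps power2_eq_square)

text \<open>Parametrized by the optimal consumption \<open>q\<close>, for which the first-order condition is
  $q^{-\gamma} = p_1$. In the application \<open>l = f\<^sup>\<gamma> \<Gamma>\<^sup>-\<^sup>\<gamma>\<^sup>-\<^sup>1\<close>,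
  \<open>G = \<Gamma>\<close> and \<open>y = g x\<^sub>0\<close>.\<close>

lemma SUP_H_cv:
  fixes mu sig_y kappa :: "real^'n" and sig :: "real^'n^'n"
  assumes gam: "gam > 0" "gam \<noteq> 1" and "dl > 0" and k: "k > 0" and q: "q > 0" and "l > 0"
    and sig: "invertible sig" and kappa: "sig *v kappa = mu - r *\<^sub>R (\<chi> i. 1)"
    and p: "q powr (- gam) = l * G"
    and P12: "x0 * P12 = - gam * l * y"
  shows "(SUP (c, B, th) \<in> {0..} \<times> {0..} \<times> UNIV.
      H_cv r dl k gam mu sig sig_y x0 (q powr (- gam)) (- gam * l) P12 c B th)
    = ereal (gam / (1 - gam) * q powr (1 - gam) * (1 + dl * k powr (1 / gam - 1))
      + l / (2 * gam) * inner (G *\<^sub>R kappa - (gam * y) *\<^sub>R sig_y) (G *\<^sub>R kappa - (gam * y) *\<^sub>R sig_y))"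
    (is "?L = ereal ?R")
proof -
  let ?a = "G *\<^sub>R kappa - (gam * y) *\<^sub>R sig_y"
  \<comment> \<open>\<open>q2\<close> is the optimal value of k B: the first-order condition k (k
    B)^(-gam) = q^(-gam) gives k B = k^(1/gam) q.\<close>
  define q2 where "q2 = k powr (1 / gam) * q"
  have q2: "q2 > 0" using assms by (simp add: q2_def)
  have q2p: "q2 powr (- gam) = q powr (- gam) / k"
    using gam k q by (simp add: q2_def powr_mult powr_powr powr_minus_divide)
  have q2p1: "q2 powr (1 - gam) = k powr (1 / gam - 1) * q powr (1 - gam)"
    using gam k q by (simp add: q2_def powr_mult powr_powr) (simp add: field_simps)
  \<comment> \<open>In terms of \<eta> = \<open>transpose sig *v th\<close>, the excess return pairs
    \<eta> with \<open>kappa\<close> and the correlation term pairs it with \<open>sig_y\<close>,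
    leaving one concave quadratic in \<eta>.\<close>
  have theta: "inner th (mu - r *\<^sub>R (\<chi> i. 1)) * q powr (- gam)
        + 1/2 * inner th ((sig ** transpose sig) *v th) * (- gam * l) + inner th (sig *v sig_y) * x0 * P12
      = l * (inner (transpose sig *v th) ?a - gam / 2 * inner (transpose sig *v th) (transpose sig *v th))" for th
    unfolding mult.assoc[of _ x0 P12] P12 p kappa[symmetric] matrix_vector_mul_assoc[symmetric]
      inner_matrix_vector_mult[of th]
    by (simp add: algebra_simps inner_diff_right)
  have split: "H_cv r dl k gam mu sig sig_y x0 (q powr (- gam)) (- gam * l) P12 c B th
    = crra gam c + ereal dl * crra gam (k * B) + ereal (- c * q powr (- gam) - dl * B * q powr (- gam)
        + l * (inner (transpose sig *v th) ?a - gam / 2 * inner (transpose sig *v th) (transpose sig *v th)))" for c B th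
    unfolding H_cv_def theta[symmetric] by (simp add: algebra_simps)
  \<comment> \<open>The tangents at \<open>q\<close> and \<open>q2\<close> have slopes p1 and p1/k,
    which are the prices of c and of k B. Hence \<open>c\<close> and \<open>B\<close> cancel and
    only the intercepts survive.\<close>
  have total: "c * q powr (- gam) + gam / (1 - gam) * q powr (1 - gam)
        + dl * (k * B * q2 powr (- gam) + gam / (1 - gam) * q2 powr (1 - gam))
        + (- c * q powr (- gam) - dl * B * q powr (- gam) + l * (X / (2 * gam)))
      = gam / (1 - gam) * q powr (1 - gam) * (1 + dl * k powr (1 / gam - 1)) + l / (2 * gam) * X" for c B X
  proof -
    have B: "k * B * q2 powr (- gam) = B * q powr (- gam)"
      using k by (simp add: q2p)
    show ?thesis unfolding B q2p1 by (simp add: algebra_simps add_divide_distrib)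
  qed
  have le: "H_cv r dl k gam mu sig sig_y x0 (q powr (- gam)) (- gam * l) P12 c B th \<le> ereal ?R"
    if "c \<ge> 0" "B \<ge> 0" for c B th
  proof -
    have "ereal dl * crra gam (k * B)
        \<le> ereal dl * ereal (k * B * q2 powr (- gam) + gam / (1 - gam) * q2 powr (1 - gam))"
      using assms \<open>B \<ge> 0\<close> q2 by (intro ereal_mult_left_mono crra_le_tangent) auto
    moreover have "crra gam c \<le> ereal (c * q powr (- gam) + gam / (1 - gam) * q powr (1 - gam))"
      using assms \<open>c \<ge> 0\<close> by (intro crra_le_tangent) auto
    moreover have "l * (inner (transpose sig *v th) ?a - gam / 2 * inner (transpose sig *v th) (transpose sig *v th))
        \<le> l * (inner ?a ?a / (2 * gam))"
      using assms by (intro mult_left_mono inner_concave_le) auto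
    ultimately have "H_cv r dl k gam mu sig sig_y x0 (q powr (- gam)) (- gam * l) P12 c B th
      \<le> ereal (c * q powr (- gam) + gam / (1 - gam) * q powr (1 - gam))
        + ereal dl * ereal (k * B * q2 powr (- gam) + gam / (1 - gam) * q2 powr (1 - gam))
        + ereal (- c * q powr (- gam) - dl * B * q powr (- gam) + l * (inner ?a ?a / (2 * gam)))"
      unfolding split by (intro add_mono) auto
    also have "\<dots> = ereal ?R"
      by (simp only: plus_ereal.simps times_ereal.simps total)
    finally show ?thesis .
  qed
  have "?L \<le> ereal ?R"
    by (rule SUP_least, elim SigmaE, simp only: prod.case, rule le) simp_all
  moreover have "ereal ?R \<le> ?L"
  proof -
    \<comment> \<open>Invertibility of \<open>sig\<close> makes \<open>transpose sig\<close>
      surjective, so some portfolio realizes the maximizing \<eta>.\<close>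
    obtain th where th: "transpose sig *v th = (1 / gam) *\<^sub>R ?a"
    proof -
      obtain S where "transpose sig ** S = mat 1"
        using transpose_invertible[OF sig] by (auto simp: invertible_def)
      then have "transpose sig *v (S *v ((1 / gam) *\<^sub>R ?a)) = (1 / gam) *\<^sub>R ?a"
        by (simp only: matrix_vector_mul_assoc matrix_vector_mul_lid)
      then show ?thesis by (rule that)
    qed
    \<comment> \<open>All three bounds are equalities at the control \<open>(q, q2 / k, th)\<close>,
      so the supremum is attained.\<close>
    have "ereal ?R = ereal (q * q powr (- gam) + gam / (1 - gam) * q powr (1 - gam))
        + ereal dl * ereal (k * (q2 / k) * q2 powr (- gam) + gam / (1 - gam) * q2 powr (1 - gam))
        + ereal (- q * q powr (- gam) - dl * (q2 / k) * q powr (- gam) + l * (inner ?a ?a / (2 * gam)))"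
      by (simp only: plus_ereal.simps times_ereal.simps total)
    also have "\<dots> = H_cv r dl k gam mu sig sig_y x0 (q powr (- gam)) (- gam * l) P12 q (q2 / k) th"
      using \<open>k > 0\<close> unfolding split th inner_concave_eq[OF gam(1)]
      by (simp add: crra_eq_tangent gam q2 \<open>q > 0\<close>)
    also have "\<dots> \<le> ?L"
      using q2 \<open>q > 0\<close> \<open>k > 0\<close> by (intro SUP_upper2[of "(q, q2 / k, th)"]) auto
    finally show ?thesis .
  qed
  ultimately show ?thesis by (rule antisym)
qed

text \<open>The algebra of the equation, with \<open>rd\<close> for rho + delta,
  \<open>alpha\<close> for r + delta, \<open>bi\<close> for \<open>beta_inf\<close>,
  \<open>X\<close> for the pairing of x1 with h, and \<open>KK\<close>, \<open>SK\<close>,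
  \<open>SS\<close> for the inner products among \<open>kappa\<close> and \<open>sig_y\<close>. The
  quantity V is l G^2.\<close>

lemma hjb_cancellation:
  fixes alpha g x0 w X G l N gam rd my bi KK SS SK :: real
  assumes gam: "gam > 0" "gam \<noteq> 1"
    and G: "G = w + g * x0 + g * X"
    and g: "g * (alpha - my + SK - bi) = 1"
    and N: "N = rd - (1 - gam) * (alpha + KK / (2 * gam))"
  shows "rd * (l * G\<^sup>2 / (1 - gam))
    = alpha * w * (l * G) + x0 * (l * G) + l * G * g * (x0 * (my + bi) + alpha * X)
      + 1/2 * SS * x0\<^sup>2 * (- gam * l * g\<^sup>2)
      + (N / (1 - gam) * (l * G\<^sup>2)
        + l / (2 * gam) * (G\<^sup>2 * KK - 2 * (gam * (g * x0)) * G * SK + (gam * (g * x0))\<^sup>2 * SS))"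
proof -
  \<comment> \<open>The equation for \<open>g\<close>, multiplied by x0, turns the drift of x0 into
    the part missing from alpha G plus the term g x0 SK.\<close>
  have "x0 + g * (x0 * (my + bi)) = alpha * (g * x0) + g * x0 * SK"
    using arg_cong[OF g, of "\<lambda>t. x0 * t"] by (simp add: algebra_simps)
  then have drift: "alpha * w * (l * G) + x0 * (l * G) + l * G * g * (x0 * (my + bi) + alpha * X)
      = l * G * (alpha * G + g * x0 * SK)"
    unfolding G by algebra
  \<comment> \<open>The cross term cancels the g x0 SK left over in \<open>drift\<close>, and the
    last one cancels the second-order term in x0.\<close>
  have quad: "l / (2 * gam) * (G\<^sup>2 * KK - 2 * (gam * (g * x0)) * G * SK + (gam * (g * x0))\<^sup>2 * SS)
      = l * G\<^sup>2 * (KK / (2 * gam)) - l * G * (g * x0 * SK) + 1/2 * gam * l * (g * x0)\<^sup>2 * SS"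
    using gam by (simp add: field_simps power2_eq_square)
  have "rd * (l * G\<^sup>2 / (1 - gam)) - N / (1 - gam) * (l * G\<^sup>2)
      = (rd - N) / (1 - gam) * (l * G\<^sup>2)"
    by (simp add: diff_divide_distrib algebra_simps)
  also have "(rd - N) / (1 - gam) = alpha + KK / (2 * gam)"
    using gam by (simp add: N)
  finally show ?thesis
    unfolding drift quad by (simp add: algebra_simps power2_eq_square)
qed

section \<open>The candidate and its derivatives\<close>

theorem proposition4p7:
  fixes d r mu_y dl k rho gam beta beta_inf beta_bar_inf b nu g_inf f_inf :: real
    and mu sig_y kappa :: "real^'n"
    and sig :: "real^'n^'n"
    and phi h_inf :: l2
    and Gamma_inf :: "real \<times> real \<times> l2 \<Rightarrow> real"
    and H_pp :: "(real \<times> real \<times> l2) set"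
  assumes "d > 0" and "invertible sig" and "phi \<in> L2 d"
    and "dl > 0" and "k > 0" and "rho > 0" and "gam \<in> {0<..<1} \<union> {1<..}"
    and kappa: "kappa = matrix_inv sig *v (mu - r *\<^sub>R (\<chi> i. 1))"
    and beta: "beta = r + dl - mu_y + inner sig_y kappa"
    and beta_inf: "beta_inf = (LINT s:{-d..0}|lborel. exp ((r + dl) * s) * rep_l2 phi s)"
    and beta_bar_inf:
      "beta_bar_inf = (LINT s:{-d..0}|lborel. exp ((r + dl) * s) * \<bar>rep_l2 phi s\<bar>)"
    and standing1: "beta - beta_bar_inf > 0"
    and standing2: "rho + dl - (1 - gam) * (r + dl + inner kappa kappa / (2 * gam)) > 0"
    and b: "b = 1 - 1 / gam"
    and nu: "nu = gam / (rho + dl - (1 - gam) * (r + dl + inner kappa kappa / (2 * gam)))"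
    and g_inf: "g_inf = 1 / (beta - beta_inf)"
    and h_inf: "h_inf = l2_of d (\<lambda>s. g_inf *
      (LINT t:{-d..s}|lborel. exp (- (r + dl) * (s - t)) * rep_l2 phi t))"
    and Gamma_inf: "Gamma_inf = (\<lambda>(w, x0, x1). w + g_inf * x0 + inner h_inf x1)"
    and H_pp: "H_pp = {z \<in> Hspace d. Gamma_inf z > 0}"
    and f_inf: "f_inf = (1 + dl * k powr (- b)) * nu"
  shows "f_inf > 0 \<and>
    classical_solution d r mu_y phi dl k rho gam mu sig sig_y H_pp
      (\<lambda>z. f_inf powr gam * Gamma_inf z powr (1 - gam) / (1 - gam))"
proof
  have gam: "gam > 0" "gam \<noteq> 1" using assms(7) by auto
  define al where "al = r + dl"
  define N where "N = rho + dl - (1 - gam) * (al + inner kappa kappa / (2 * gam))"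
  have N: "N > 0" using standing2 by (simp add: N_def al_def)
  have nu_N: "nu = gam / N" by (simp add: nu N_def al_def)
  define K where "K = 1 + dl * k powr (1 / gam - 1)"
  have f_K: "f_inf = K * nu" by (simp add: f_inf b K_def)
  have K: "K > 0" using \<open>dl > 0\<close> by (simp add: K_def add_pos_nonneg)
  show f: "f_inf > 0" using K N gam by (simp add: f_K nu_N)

  define h where "h = l2_of d (duhamel d al phi)"
  have sq: "sq_integrable (\<lambda>s. indicator {-d..0} s * duhamel d al phi s)"
    using \<open>phi \<in> L2 d\<close> by (rule sq_integrable_duhamel)
  have h_inf_h: "h_inf = g_inf *\<^sub>R h"
    unfolding h_inf h_def duhamel_def[abs_def] al_def
    by (rule l2_of_scale[OF sq[unfolded duhamel_def al_def]])
  have beta_inf_h: "beta_inf = duhamel d al phi 0"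
    by (simp add: beta_inf duhamel_zero al_def)
  \<comment> \<open>This bound and the first standing assumption make the denominator of
    \<open>g_inf\<close> positive, so the quotient is not a division by zero.\<close>
  have "\<bar>beta_inf\<bar> \<le> beta_bar_inf"
    using integral_abs_bound[of lborel "\<lambda>s. indicator {-d..0} s *\<^sub>R (exp ((r + dl) * s) * rep_l2 phi s)"]
    by (simp add: beta_inf beta_bar_inf set_lebesgue_integral_def abs_mult)
  then have "beta - beta_inf > 0" using standing1 by linarith
  then have g: "g_inf * (al - mu_y + inner sig_y kappa - beta_inf) = 1"
    by (simp add: g_inf beta al_def)
  have sig_kappa: "sig *v kappa = mu - r *\<^sub>R (\<chi> i. 1)"
  proof -
    have "sig ** matrix_inv sig = mat 1"
      using \<open>invertible sig\<close> someI_ex[of "\<lambda>A. sig ** A = mat 1 \<and> A ** sig = mat 1"]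
      by (simp add: invertible_def matrix_inv_def)
    then show ?thesis by (simp add: kappa matrix_vector_mul_assoc)
  qed

  \<comment> \<open>\<Gamma> is the inner product with a fixed vector, so the candidate is a real
    function of a continuous linear form and its gradient is a scalar times
    \<open>v\<close>.\<close>
  define v where "v = (1 :: real, g_inf, h_inf)"
  have Gam: "Gamma_inf z = inner v z" for z
    by (cases z) (simp add: Gamma_inf v_def)
  define F where "F = f_inf powr gam"
  \<comment> \<open>\<open>p\<close> and \<open>- gam * l\<close> are the first and second
    derivatives of the candidate as a function of \<Gamma>.\<close>
  define l where "l z = F * Gamma_inf z powr (- gam - 1)" for z
  define p where "p z = F * Gamma_inf z powr (- gam)" for z
  define Du where "Du z = p z *\<^sub>R v" for z
  \<comment> \<open>The outer product of (1, g_inf), the (w, x0) part of \<open>v\<close>, with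
    itself.\<close>
  define M :: "real^2^2" where "M = vector [vector [1, g_inf], vector [g_inf, g_inf\<^sup>2]]"
  define D2u where "D2u z = (- gam * l z) *\<^sub>R M" for z
  have pos: "Gamma_inf z > 0" if "z \<in> H_pp" for z using that by (simp add: H_pp)
  have p_l: "p z = l z * Gamma_inf z" if "z \<in> H_pp" for z
    using pos[OF that] by (simp add: p_def l_def powr_diff)
  have cont_p: "continuous_on H_pp p" and cont_l: "continuous_on H_pp l"
  proof -
    have "continuous_on H_pp Gamma_inf"
      unfolding Gam[abs_def] by (intro continuous_intros)
    moreover have "\<forall>z\<in>H_pp. Gamma_inf z \<noteq> 0"
      using pos by (metis less_irrefl)
    ultimately show "continuous_on H_pp p" "continuous_on H_pp l"
      unfolding p_def l_def by (auto intro!: continuous_intros)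
  qed
  have snd_Du: "snd (Du z) = (p z * g_inf, (p z * g_inf) *\<^sub>R h)" for z
    by (simp add: Du_def v_def h_inf_h)
  have Astar_Du: "Astar d mu_y phi (snd (Du z)) = (p z * g_inf) *\<^sub>R (mu_y + beta_inf, al *\<^sub>R h)" for z
    unfolding snd_Du h_def beta_inf_h by (rule Astar_duhamel) fact+

  \<comment> \<open>Regularity of the candidate\<close>
  have "has_gradient_on d H_pp (\<lambda>z. F * Gamma_inf z powr (1 - gam) / (1 - gam)) Du"
    unfolding has_gradient_on_def
  proof
    fix z assume z: "z \<in> H_pp"
    have "h_inf \<in> L2 d"
      unfolding h_inf_h h_def by (intro L2_scaleR l2_of_in_L2 sq)
    then have "Du z \<in> Hspace d"
      by (simp add: Du_def v_def Hspace_def M2_def L2_scaleR)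
    moreover have "((\<lambda>t. F * t powr (1 - gam) / (1 - gam)) has_real_derivative p z) (at (Gamma_inf z))"
      using pos[OF z] gam unfolding p_def by (auto intro!: derivative_eq_intros has_real_derivative_powr)
    then have "((\<lambda>z. F * inner v z powr (1 - gam) / (1 - gam)) has_derivative (\<lambda>h. inner v h * p z)) (at z within H_pp)"
      unfolding Gam by (rule DERIV_compose_FDERIV) (intro derivative_intros)
    ultimately show "Du z \<in> Hspace d \<and> ((\<lambda>z. F * Gamma_inf z powr (1 - gam) / (1 - gam)) has_derivative
        (\<lambda>h. inner (Du z) h)) (at z within H_pp)"
      by (simp add: Gam Du_def mult.commute)
  qed
  moreover have "continuous_on H_pp Du" "continuous_on H_pp D2u"
    "continuous_on H_pp (\<lambda>z. Astar d mu_y phi (snd (Du z)))"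
    unfolding Astar_Du unfolding Du_def D2u_def by (intro continuous_intros cont_p cont_l)+
  moreover have "snd (Du z) \<in> dom_Astar d" for z
    unfolding snd_Du h_def by (intro duhamel_in_dom_Astar) fact+
  moreover have "has_second_derivs_on H_pp Du D2u"
    unfolding has_second_derivs_on_def
  proof (intro allI impI)
    fix w x0 x1 assume z: "(w, x0, x1) \<in> H_pp"
    have "((\<lambda>t. F * t powr (- gam)) has_real_derivative - gam * l (w, x0, x1)) (at (Gamma_inf (w, x0, x1)))"
      using pos[OF z] unfolding l_def by (auto intro!: derivative_eq_intros has_real_derivative_powr)
    note outer = this[unfolded Gamma_inf prod.case]
    have w: "((\<lambda>t. p (t, x0, x1)) has_real_derivative - gam * l (w, x0, x1) * 1) (at w)"
      unfolding p_def Gamma_inf prod.case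
      by (rule DERIV_chain2[where g = "\<lambda>t. t + g_inf * x0 + inner h_inf x1" and x = w, OF outer])
        (auto intro!: derivative_eq_intros)
    have x: "((\<lambda>t. p (w, t, x1)) has_real_derivative - gam * l (w, x0, x1) * g_inf) (at x0)"
      unfolding p_def Gamma_inf prod.case
      by (rule DERIV_chain2[where g = "\<lambda>t. w + g_inf * t + inner h_inf x1" and x = x0, OF outer])
        (auto intro!: derivative_eq_intros)
    show "((\<lambda>t. fst (Du (t, x0, x1))) has_real_derivative D2u (w, x0, x1) $ 1 $ 1) (at w) \<and>
        ((\<lambda>t. fst (Du (w, t, x1))) has_real_derivative D2u (w, x0, x1) $ 1 $ 2) (at x0) \<and>
        ((\<lambda>t. fst (snd (Du (t, x0, x1)))) has_real_derivative D2u (w, x0, x1) $ 2 $ 1) (at w) \<and>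
        ((\<lambda>t. fst (snd (Du (w, t, x1)))) has_real_derivative D2u (w, x0, x1) $ 2 $ 2) (at x0)"
      using w x DERIV_cmult_right[OF w, of g_inf] DERIV_cmult_right[OF x, of g_inf]
      by (simp add: Du_def D2u_def M_def v_def power2_eq_square mult.assoc)
  qed

  \<comment> \<open>The HJB equation at a point of \<open>H_pp\<close>\<close>
  moreover have "ereal ((rho + dl) * (F * Gamma_inf (w, x) powr (1 - gam) / (1 - gam)))
      - hamiltonian d r mu_y phi dl k gam mu sig sig_y w x (Du (w, x)) (D2u (w, x)) = 0"
    if z: "(w, x) \<in> H_pp" for w x
  proof -
    obtain x0 x1 where x: "x = (x0, x1)" by (cases x)
    define G where "G = Gamma_inf (w, x)"
    define L where "L = l (w, x)"
    have G: "G > 0" using pos[OF z] by (simp add: G_def)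
    have F: "F > 0" using f by (simp add: F_def)
    have L: "L > 0" using F G by (simp add: L_def l_def G_def)
    \<comment> \<open>The optimal consumption: f_inf^gam G^(-gam) = (G/f_inf)^(-gam), so
      \<open>q\<close> solves the first-order condition.\<close>
    define q where "q = G / f_inf"
    have q: "q > 0" using G f by (simp add: q_def)
    have pz: "p (w, x) = L * G" using p_l[OF z] by (simp add: L_def G_def)
    have qp: "q powr (- gam) = L * G"
      using f G unfolding pz[symmetric]
      by (simp add: q_def p_def F_def G_def powr_divide powr_minus field_simps)
    \<comment> \<open>In terms of \<open>L\<close> and \<open>G\<close> no powers with exponent gam
      remain, so the equation reduces to the algebra of \<open>hjb_cancellation\<close>.\<close>
    have FG: "F * G powr (1 - gam) = L * G\<^sup>2"
      using G by (simp add: L_def l_def G_def powr_diff powr_minus power2_eq_square field_simps)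
    have "q powr (1 - gam) = q * q powr (- gam)"
      using q by (simp add: powr_diff powr_minus field_simps)
    then have "q powr (1 - gam) = L * G\<^sup>2 / f_inf"
      unfolding qp by (simp add: q_def power2_eq_square)
    \<comment> \<open>The choice of \<open>f_inf\<close> enters here: f_inf = K gam / N, so gam K /
      f_inf = N.\<close>
    then have qK: "gam / (1 - gam) * q powr (1 - gam) * K = N / (1 - gam) * (L * G\<^sup>2)"
      using K N gam by (simp add: f_K nu_N)
    have "(SUP (c, B, th) \<in> {0..} \<times> {0..} \<times> UNIV.
        H_cv r dl k gam mu sig sig_y x0 (q powr (- gam)) (- gam * L) (- gam * L * g_inf) c B th)
      = ereal (gam / (1 - gam) * q powr (1 - gam) * (1 + dl * k powr (1 / gam - 1))
        + L / (2 * gam) * inner (G *\<^sub>R kappa - (gam * (g_inf * x0)) *\<^sub>R sig_y)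
            (G *\<^sub>R kappa - (gam * (g_inf * x0)) *\<^sub>R sig_y))"
      by (rule SUP_H_cv[OF gam \<open>dl > 0\<close> \<open>k > 0\<close> q L \<open>invertible sig\<close> sig_kappa qp]) simp
    also have "\<dots> = ereal (N / (1 - gam) * (L * G\<^sup>2)
        + L / (2 * gam) * (G\<^sup>2 * inner kappa kappa - 2 * (gam * (g_inf * x0)) * G * inner sig_y kappa
          + (gam * (g_inf * x0))\<^sup>2 * inner sig_y sig_y))"
      unfolding K_def[symmetric] qK
      by (simp add: inner_diff inner_commute[of kappa sig_y] power2_eq_square algebra_simps)
    finally have sup: "(SUP (c, B, th) \<in> {0..} \<times> {0..} \<times> UNIV.
        H_cv r dl k gam mu sig sig_y x0 (L * G) (- gam * L) (- gam * L * g_inf) c B th) = \<dots>"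
      unfolding qp .
    have G_eq: "G = w + g_inf * x0 + g_inf * inner x1 h"
      by (simp add: G_def Gamma_inf x h_inf_h inner_commute)
    have ham: "hamiltonian d r mu_y phi dl k gam mu sig sig_y w x (Du (w, x)) (D2u (w, x))
        = ereal (al * w * (L * G) + x0 * (L * G) + L * G * g_inf * (x0 * (mu_y + beta_inf) + al * inner x1 h)
            + 1/2 * inner sig_y sig_y * x0\<^sup>2 * (- gam * L * g_inf\<^sup>2))
          + ereal (N / (1 - gam) * (L * G\<^sup>2)
            + L / (2 * gam) * (G\<^sup>2 * inner kappa kappa - 2 * (gam * (g_inf * x0)) * G * inner sig_y kappa
              + (gam * (g_inf * x0))\<^sup>2 * inner sig_y sig_y))"
    proof -
      have "fst (Du (w, x)) = L * G" by (simp add: Du_def v_def pz)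
      moreover have "D2u (w, x) $ 1 $ 1 = - gam * L" "D2u (w, x) $ 1 $ 2 = - gam * L * g_inf"
        "D2u (w, x) $ 2 $ 2 = - gam * L * g_inf\<^sup>2"
        by (simp_all add: D2u_def M_def L_def)
      moreover have "inner x (Astar d mu_y phi (snd (Du (w, x))))
          = L * G * g_inf * (x0 * (mu_y + beta_inf) + al * inner x1 h)"
        unfolding Astar_Du pz by (simp add: x algebra_simps)
      ultimately show ?thesis
        unfolding hamiltonian_def by (simp only: sup x fst_conv al_def)
    qed
    have "(rho + dl) * (F * Gamma_inf (w, x) powr (1 - gam) / (1 - gam)) = (rho + dl) * (L * G\<^sup>2 / (1 - gam))"
      unfolding G_def[symmetric] FG ..
    with hjb_cancellation[OF gam G_eq g N_def, of L "inner sig_y sig_y"]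
    show ?thesis unfolding ham by simp
  qed
  ultimately show "classical_solution d r mu_y phi dl k rho gam mu sig sig_y H_pp
      (\<lambda>z. f_inf powr gam * Gamma_inf z powr (1 - gam) / (1 - gam))"
    unfolding classical_solution_def F_def[symmetric] by blast
qed

end
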